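(* Let $n\ge1$. For all $k\in\{0,1,\dots,n\}$, all $f:\{-1,1\}^n\to[-1,1]$, and all $1\le q\le p\le 2$ with $q<2$, $$\frac{\big\||\nabla^kf|\big\|_{L^p}^{p}}{\Big[1+\frac{q}{2k(2-q)}\ln^{+}\Big(\big\||\nabla^kf|\big\|_{L^p}^{p}/\big\||\nabla^kf|\big\|_{L^q}^{2}\Big)\Big]^{kp/2}}\ \ge\ C(p,q)^k\,W^{\ge k}(f),$$ where $$C(p,q)=\Big(M(p)^{-\frac2p}+\frac{pq}{4e(2-q)}\Big)^{-\frac p2},\qquad M(p):=p\,2^{-\frac p2}\max_{x\ge0}\frac{1-e^{-x}}{x^{p/2}}.$$ Moreover there is an absolute constant $c>0$ with $C(p,q)\ge c\,(2-q)$ for all such $p,q$.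
   Context: The cube $\{-1,1\}^n$ carries the uniform probability measure; $L^p$ norms and the $L^2$ inner product are with respect to it. For $f:\{-1,1\}^n\to\mathbb R$ and $i\in[n]=\{1,\dots,n\}$, $D_i f(x)=\frac{1}{2}\big(f(x^{(i\mapsto 1)})-f(x^{(i\mapsto -1)})\big)$, where $x^{(i\mapsto\pm1)}$ is $x$ with its $i$-th coordinate replaced by $\pm1$. For $J\subseteq[n]$, $D_J:=\prod_{i\in J}D_i$, with $D_\varnothing$ the identity. For $0\le k\le n$, $\nabla^k f:=(D_Jf)_{|J|=k}$ and $|\nabla^k f|^2:=\sum_{|J|=k}|D_Jf|^2$ (pointwise). $f^{\ge k}$ is the component of $f$ orthogonal in $L^2$ to the null space of $\nabla^k$, and $W^{\ge k}(f):=\|f^{\ge k}\|_{L^2}^2$; equivalently $W^{\ge k}(f)=\sum_{|S|\ge k}\widehat f(S)^2$ with $\widehat f(S)=\mathbb E[f\chi_S]$, $\chi_S(x)=\prod_{i\in S}x_i$. $\ln^+(x)=\max\{\ln x,0\}$. In $M(p)$ the value at $x=0$ is taken as the limit $x\to0^+$. Conventions: the left-hand side is $0$ if $\nabla^kf=0$; for $k=0$ the bracket raised to the power $0$ equals $1$. *)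

theory Defs
  imports "HOL-Probability.Probability" "HOL-Real_Asymp.Real_Asymp"
begin

section \<open>The discrete cube and its \<open>L\<^sup>p\<close> norms\<close>

text \<open>
  A function on the cube is represented by a total function \<open>f\<close> of type
  \<open>(nat \<Rightarrow> real) \<Rightarrow> real\<close>, of which only the values on \<open>cube n\<close> are ever used.
\<close>

definition cube :: "nat \<Rightarrow> (nat \<Rightarrow> real) set" where
  "cube n = (\<Pi>\<^sub>E i\<in>{1..n}. {-1, 1})"

definition cube_expectation :: "nat \<Rightarrow> ((nat \<Rightarrow> real) \<Rightarrow> real) \<Rightarrow> real" where
  "cube_expectation n g = measure_pmf.expectation (pmf_of_set (cube n)) g"

definition cube_norm :: "nat \<Rightarrow> real \<Rightarrow> ((nat \<Rightarrow> real) \<Rightarrow> real) \<Rightarrow> real" where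
  "cube_norm n p g = cube_expectation n (\<lambda>x. \<bar>g x\<bar> powr p) powr (1 / p)"


section \<open>Discrete derivatives\<close>

definition deriv1 :: "nat \<Rightarrow> ((nat \<Rightarrow> real) \<Rightarrow> real) \<Rightarrow> (nat \<Rightarrow> real) \<Rightarrow> real" where
  "deriv1 i f x = (f (x(i := 1)) - f (x(i := -1))) / 2"

text \<open>
  The composition of the commuting operators \<open>deriv1 i\<close> for \<open>i \<in> J\<close>; see
  \<open>derivs_empty\<close> and \<open>derivs_insert\<close> below.
\<close>

definition derivs :: "nat set \<Rightarrow> ((nat \<Rightarrow> real) \<Rightarrow> real) \<Rightarrow> (nat \<Rightarrow> real) \<Rightarrow> real" where
  "derivs J f = Finite_Set.fold deriv1 f J"

text \<open>The pointwise Euclidean length of the family of all derivatives of order \<open>k\<close>.\<close>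

definition grad_norm :: "nat \<Rightarrow> nat \<Rightarrow> ((nat \<Rightarrow> real) \<Rightarrow> real) \<Rightarrow> (nat \<Rightarrow> real) \<Rightarrow> real" where
  "grad_norm n k f x = sqrt (\<Sum>J | J \<subseteq> {1..n} \<and> card J = k. (derivs J f x)\<^sup>2)"

definition grad_null :: "nat \<Rightarrow> nat \<Rightarrow> ((nat \<Rightarrow> real) \<Rightarrow> real) set" where
  "grad_null n k = {h. \<forall>J. J \<subseteq> {1..n} \<and> card J = k \<longrightarrow> (\<forall>x\<in>cube n. derivs J h x = 0)}"

text \<open>
  The component of \<open>f\<close> orthogonal to \<open>grad_null n k\<close>. Membership in \<open>extensional\<close> fixes the
  irrelevant values outside the cube; existence and uniqueness are proved in
  \<open>ex1_high_part\<close> below.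
\<close>

definition is_high_part ::
    "nat \<Rightarrow> nat \<Rightarrow> ((nat \<Rightarrow> real) \<Rightarrow> real) \<Rightarrow> ((nat \<Rightarrow> real) \<Rightarrow> real) \<Rightarrow> bool" where
  "is_high_part n k f g \<longleftrightarrow>
     g \<in> extensional (cube n) \<and>
     (\<lambda>x. f x - g x) \<in> grad_null n k \<and>
     (\<forall>h\<in>grad_null n k. cube_expectation n (\<lambda>x. g x * h x) = 0)"

definition high_part :: "nat \<Rightarrow> nat \<Rightarrow> ((nat \<Rightarrow> real) \<Rightarrow> real) \<Rightarrow> (nat \<Rightarrow> real) \<Rightarrow> real" where
  "high_part n k f = (THE g. is_high_part n k f g)"

definition high_weight :: "nat \<Rightarrow> nat \<Rightarrow> ((nat \<Rightarrow> real) \<Rightarrow> real) \<Rightarrow> real" where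
  "high_weight n k f = (cube_norm n 2 (high_part n k f))\<^sup>2"


section \<open>The constants\<close>

text \<open>
  With \<open>x / 0 = 0\<close>, \<open>ln 0 = 0\<close> and \<open>0 powr a = 0\<close>, a quotient
  \<open>N powr p / (1 + a / (2 * k * b) * ln_plus (N powr p / N'\<^sup>2)) powr (k * p / 2)\<close> equals
  \<open>N powr p\<close> when \<open>k = 0\<close>, and \<open>0\<close> when \<open>N = 0\<close>.
\<close>

definition ln_plus :: "real \<Rightarrow> real" where
  "ln_plus x = max (ln x) 0"

definition M_fun :: "real \<Rightarrow> real \<Rightarrow> real" where
  "M_fun p x =
     (if x = 0 then Lim (at_right 0) (\<lambda>y. (1 - exp (- y)) / y powr (p / 2))
      else (1 - exp (- x)) / x powr (p / 2))"

text \<open>For \<open>1 \<le> p \<le> 2\<close> the supremum is a maximum; see \<open>M_fun_attains_max\<close> below.\<close>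

definition M_const :: "real \<Rightarrow> real" where
  "M_const p = p * 2 powr (- p / 2) * (SUP x\<in>{0..}. M_fun p x)"

definition C_const :: "real \<Rightarrow> real \<Rightarrow> real" where
  "C_const p q = (M_const p powr (- 2 / p) + p * q / (4 * exp 1 * (2 - q))) powr (- p / 2)"


section \<open>Well-definedness\<close>

lemma finite_cube [simp]: "finite (cube n)"
  by (auto simp: cube_def intro: finite_PiE)

lemma cube_nonempty [simp]: "cube n \<noteq> {}"
  by (auto simp: cube_def PiE_eq_empty_iff)

lemma card_cube: "card (cube n) = 2 ^ n"
  by (simp add: cube_def card_PiE numeral_2_eq_2)

lemma cube_expectation_eq: "cube_expectation n g = (\<Sum>x\<in>cube n. g x) / 2 ^ n"
  by (simp add: cube_expectation_def integral_pmf_of_set card_cube)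

lemma cube_upd: "x \<in> cube n \<Longrightarrow> i \<in> {1..n} \<Longrightarrow> v \<in> {-1, 1} \<Longrightarrow> x(i := v) \<in> cube n"
  by (auto simp: cube_def PiE_iff extensional_def)

lemma comp_fun_commute_deriv1: "comp_fun_commute deriv1"
proof
  fix i j
  show "deriv1 j \<circ> deriv1 i = deriv1 i \<circ> deriv1 j"
    by (cases "i = j") (auto simp: fun_eq_iff deriv1_def fun_upd_twist field_simps)
qed

lemma derivs_empty: "derivs {} f = f"
  by (simp add: derivs_def)

lemma derivs_insert:
  assumes "finite J" "i \<notin> J"
  shows "derivs (insert i J) f = deriv1 i (derivs J f)"
proof -
  interpret comp_fun_commute deriv1 by (rule comp_fun_commute_deriv1)
  show ?thesis using assms by (simp add: derivs_def)
qed

lemma derivs_cong: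
  assumes "J \<subseteq> {1..n}" "\<And>x. x \<in> cube n \<Longrightarrow> f x = g x" "x \<in> cube n"
  shows "derivs J f x = derivs J g x"
proof -
  have "finite J" using assms(1) finite_subset by blast
  then show ?thesis using assms
    by (induction J arbitrary: x rule: finite_induct)
       (simp_all add: derivs_empty derivs_insert deriv1_def cube_upd)
qed

lemma derivs_sum:
  assumes "finite J" "finite T"
  shows "derivs J (\<lambda>x. \<Sum>S\<in>T. a S * g S x) x = (\<Sum>S\<in>T. a S * derivs J (g S) x)"
  using assms(1)
  by (induction J arbitrary: x rule: finite_induct)
     (simp_all add: derivs_empty derivs_insert deriv1_def sum_subtractf[symmetric]
        sum_divide_distrib algebra_simps)

definition walsh :: "nat set \<Rightarrow> (nat \<Rightarrow> real) \<Rightarrow> real" where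
  "walsh S x = (\<Prod>i\<in>S. x i)"

definition fourier :: "nat \<Rightarrow> ((nat \<Rightarrow> real) \<Rightarrow> real) \<Rightarrow> nat set \<Rightarrow> real" where
  "fourier n f S = cube_expectation n (\<lambda>x. f x * walsh S x)"

lemma derivs_walsh:
  assumes "finite J" "finite S"
  shows "derivs J (walsh S) x = (if J \<subseteq> S then walsh (S - J) x else 0)"
  using assms(1)
proof (induction J arbitrary: x rule: finite_induct)
  case empty
  then show ?case by (simp add: derivs_empty)
next
  case (insert i J)
  have upd: "walsh A (x(i := v)) = (if i \<in> A then v * walsh (A - {i}) x else walsh A x)"
    if "finite A" for A v
  proof (cases "i \<in> A")
    case True
    have "walsh A (x(i := v)) = v * (\<Prod>j\<in>A - {i}. (x(i := v)) j)"
      using True that by (simp add: walsh_def prod.remove)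
    also have "(\<Prod>j\<in>A - {i}. (x(i := v)) j) = walsh (A - {i}) x"
      unfolding walsh_def by (rule prod.cong) auto
    finally show ?thesis using True by (simp only: if_True)
  next
    case False
    then have "walsh A (x(i := v)) = walsh A x"
      unfolding walsh_def by (intro prod.cong) auto
    then show ?thesis using False by simp
  qed
  have "S - J - {i} = S - insert i J" by auto
  then show ?case using insert assms(2)
    by (auto simp: derivs_insert deriv1_def upd)
qed

lemma walsh_orthonormal:
  assumes "S \<subseteq> {1..n}" "T \<subseteq> {1..n}"
  shows "cube_expectation n (\<lambda>x. walsh S x * walsh T x) = (if S = T then 1 else 0)"
proof -
  have ext: "walsh A x = (\<Prod>i\<in>{1..n}. if i \<in> A then x i else 1)" if "A \<subseteq> {1..n}" for A x
    using that by (simp add: walsh_def prod.If_cases Int_absorb1)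
  have "(\<Sum>x\<in>cube n. walsh S x * walsh T x) =
     (\<Sum>x\<in>cube n. \<Prod>i\<in>{1..n}. (if i \<in> S then x i else 1) * (if i \<in> T then x i else 1))"
    by (simp only: ext[OF assms(1)] ext[OF assms(2)] prod.distrib)
  also have "\<dots> = (\<Prod>i\<in>{1..n}. \<Sum>v\<in>{-1, 1}. (if i \<in> S then v else 1) * (if i \<in> T then v else 1))"
    unfolding cube_def by (rule prod_sum_PiE[symmetric]) auto
  also have "\<dots> = (\<Prod>i\<in>{1..n}. if i \<in> S \<longleftrightarrow> i \<in> T then 2 else 0)"
    by (rule prod.cong) auto
  also have "\<dots> = (if S = T then 2 ^ n else 0)"
  proof (cases "S = T")
    case False
    then obtain i where "i \<in> {1..n}" "(i \<in> S) \<noteq> (i \<in> T)" using assms by blast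
    then show ?thesis using False by (auto intro!: prod_zero bexI[of _ i])
  qed auto
  finally show ?thesis by (simp add: cube_expectation_eq)
qed

lemma walsh_inversion:
  assumes x: "x \<in> cube n"
  shows "f x = (\<Sum>S\<in>Pow {1..n}. fourier n f S * walsh S x)"
proof -
  have kernel: "(\<Sum>S\<in>Pow {1..n}. walsh S y * walsh S x) = (if y = x then 2 ^ n else 0)"
    if y: "y \<in> cube n" for y
  proof -
    have "(\<Sum>S\<in>Pow {1..n}. walsh S y * walsh S x) = (\<Prod>i\<in>{1..n}. y i * x i + 1)"
      by (subst prod_add) (simp_all add: walsh_def prod.distrib)
    also have "\<dots> = (if y = x then 2 ^ n else 0)"
    proof (cases "y = x")
      case True
      have "y i * x i + 1 = 2" if "i \<in> {1..n}" for i
      proof -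
        have "x i \<in> {-1, 1}" using x that unfolding cube_def by (rule PiE_mem)
        then show ?thesis using True by auto
      qed
      then show ?thesis using True by simp
    next
      case False
      then obtain i where i: "i \<in> {1..n}" "y i \<noteq> x i"
        using PiE_ext[OF y[unfolded cube_def] x[unfolded cube_def]] by blast
      have "x i \<in> {-1, 1}" "y i \<in> {-1, 1}"
        using PiE_mem[OF x[unfolded cube_def] i(1)] PiE_mem[OF y[unfolded cube_def] i(1)] .
      then have "y i * x i + 1 = 0" using i(2) by auto
      then have "(\<Prod>i\<in>{1..n}. y i * x i + 1) = 0"
        using i(1) by (intro prod_zero) auto
      then show ?thesis using False by simp
    qed
    finally show ?thesis .
  qed
  have "(\<Sum>S\<in>Pow {1..n}. fourier n f S * walsh S x) =
     (\<Sum>S\<in>Pow {1..n}. \<Sum>y\<in>cube n. f y * (walsh S y * walsh S x) / 2 ^ n)"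
    by (simp add: fourier_def cube_expectation_eq sum_distrib_left sum_distrib_right
        sum_divide_distrib mult_ac)
  also have "\<dots> = (\<Sum>y\<in>cube n. \<Sum>S\<in>Pow {1..n}. f y * (walsh S y * walsh S x) / 2 ^ n)"
    by (rule sum.swap)
  also have "\<dots> = (\<Sum>y\<in>cube n. f y * (\<Sum>S\<in>Pow {1..n}. walsh S y * walsh S x) / 2 ^ n)"
    by (simp add: sum_distrib_left sum_divide_distrib)
  also have "\<dots> = (\<Sum>y\<in>cube n. if y = x then f y else 0)"
    by (rule sum.cong) (simp_all only: kernel, simp_all)
  also have "\<dots> = f x" using x by simp
  finally show ?thesis by simp
qed

lemma fourier_walsh_sum:
  assumes "U \<subseteq> Pow {1..n}" "T \<subseteq> {1..n}" "\<And>x. x \<in> cube n \<Longrightarrow> f x = (\<Sum>S\<in>U. a S * walsh S x)"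
  shows "fourier n f T = (if T \<in> U then a T else 0)"
proof -
  have fin: "finite U" using assms(1) finite_subset by blast
  have "fourier n f T = (\<Sum>x\<in>cube n. \<Sum>S\<in>U. a S * (walsh S x * walsh T x)) / 2 ^ n"
    unfolding fourier_def cube_expectation_eq
    by (simp add: assms(3) sum_distrib_left sum_distrib_right mult_ac)
  also have "\<dots> = (\<Sum>S\<in>U. a S * cube_expectation n (\<lambda>x. walsh S x * walsh T x))"
    by (subst sum.swap) (simp add: cube_expectation_eq sum_distrib_left sum_divide_distrib)
  also have "\<dots> = (\<Sum>S\<in>U. if S = T then a S else 0)"
  proof (rule sum.cong)
    fix S assume "S \<in> U"
    then have "S \<subseteq> {1..n}" using assms(1) by blast
    then show "a S * cube_expectation n (\<lambda>x. walsh S x * walsh T x) = (if S = T then a S else 0)"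
      using assms(2) by (simp only: walsh_orthonormal) simp
  qed simp
  also have "\<dots> = (if T \<in> U then a T else 0)" using fin by simp
  finally show ?thesis .
qed

lemma parseval:
  "cube_expectation n (\<lambda>x. f x * g x) = (\<Sum>S\<in>Pow {1..n}. fourier n f S * fourier n g S)"
proof -
  have "(\<Sum>x\<in>cube n. f x * g x) = (\<Sum>x\<in>cube n. \<Sum>S\<in>Pow {1..n}. fourier n f S * (g x * walsh S x))"
  proof (rule sum.cong)
    fix x assume "x \<in> cube n"
    then have "f x = (\<Sum>S\<in>Pow {1..n}. fourier n f S * walsh S x)" by (rule walsh_inversion)
    then have "f x * g x = (\<Sum>S\<in>Pow {1..n}. fourier n f S * walsh S x) * g x" by (rule arg_cong)
    then show "f x * g x = (\<Sum>S\<in>Pow {1..n}. fourier n f S * (g x * walsh S x))"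
      by (simp add: sum_distrib_left mult_ac)
  qed simp
  also have "\<dots> = (\<Sum>S\<in>Pow {1..n}. \<Sum>x\<in>cube n. fourier n f S * (g x * walsh S x))"
    by (rule sum.swap)
  finally show ?thesis
    by (simp add: cube_expectation_eq fourier_def sum_distrib_left sum_divide_distrib)
qed

lemma derivs_fourier:
  assumes "J \<subseteq> {1..n}" "x \<in> cube n"
  shows "derivs J f x = (\<Sum>S | J \<subseteq> S \<and> S \<subseteq> {1..n}. fourier n f S * walsh (S - J) x)"
proof -
  have finJ: "finite J" using assms(1) finite_subset by blast
  have "derivs J f x = derivs J (\<lambda>x. \<Sum>S\<in>Pow {1..n}. fourier n f S * walsh S x) x"
    by (rule derivs_cong[OF assms(1) _ assms(2)]) (rule walsh_inversion)
  also have "\<dots> = (\<Sum>S\<in>Pow {1..n}. fourier n f S * derivs J (walsh S) x)"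
    using finJ by (rule derivs_sum) simp
  also have "\<dots> = (\<Sum>S\<in>Pow {1..n}. if J \<subseteq> S then fourier n f S * walsh (S - J) x else 0)"
    using finJ by (intro sum.cong) (auto simp: derivs_walsh finite_subset)
  also have "\<dots> = (\<Sum>S | J \<subseteq> S \<and> S \<subseteq> {1..n}. fourier n f S * walsh (S - J) x)"
    by (rule sum.mono_neutral_cong_right) auto
  finally show ?thesis .
qed

lemma grad_null_iff:
  "h \<in> grad_null n k \<longleftrightarrow> (\<forall>S. S \<subseteq> {1..n} \<and> k \<le> card S \<longrightarrow> fourier n h S = 0)"
proof
  assume h: "h \<in> grad_null n k"
  show "\<forall>S. S \<subseteq> {1..n} \<and> k \<le> card S \<longrightarrow> fourier n h S = 0"
  proof (intro allI impI)
    fix S assume S: "S \<subseteq> {1..n} \<and> k \<le> card S"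
    then obtain J where J: "J \<subseteq> S" "card J = k" "finite J"
      by (metis obtain_subset_with_card_n)
    let ?U = "(\<lambda>S. S - J) ` {S. J \<subseteq> S \<and> S \<subseteq> {1..n}}"
    have Jn: "J \<subseteq> {1..n}" using J S by auto
    have "derivs J h x = (\<Sum>T\<in>?U. fourier n h (T \<union> J) * walsh T x)" if "x \<in> cube n" for x
    proof -
      have "inj_on (\<lambda>S. S - J) {S. J \<subseteq> S \<and> S \<subseteq> {1..n}}"
        by (auto simp: inj_on_def)
      then have "(\<Sum>T\<in>?U. fourier n h (T \<union> J) * walsh T x) =
          (\<Sum>S | J \<subseteq> S \<and> S \<subseteq> {1..n}. fourier n h (S - J \<union> J) * walsh (S - J) x)"
        by (simp add: sum.reindex)
      also have "\<dots> = (\<Sum>S | J \<subseteq> S \<and> S \<subseteq> {1..n}. fourier n h S * walsh (S - J) x)"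
        by (rule sum.cong) (auto simp: Un_absorb2)
      finally show ?thesis using derivs_fourier[OF Jn that] by simp
    qed
    then have "fourier n (derivs J h) (S - J) =
        (if S - J \<in> ?U then fourier n h (S - J \<union> J) else 0)"
      using S by (intro fourier_walsh_sum) auto
    also have "\<dots> = fourier n h S" using S J by (auto simp: Un_absorb2)
    finally have "fourier n h S = fourier n (derivs J h) (S - J)" ..
    also have "\<dots> = 0"
      using h Jn J(2) by (simp add: grad_null_def fourier_def cube_expectation_eq)
    finally show "fourier n h S = 0" .
  qed
next
  assume *: "\<forall>S. S \<subseteq> {1..n} \<and> k \<le> card S \<longrightarrow> fourier n h S = 0"
  show "h \<in> grad_null n k"
    unfolding grad_null_def
  proof (intro CollectI allI impI ballI)
    fix J x assume J: "J \<subseteq> {1..n} \<and> card J = k" and x: "x \<in> cube n"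
    have "fourier n h S = 0" if "J \<subseteq> S" "S \<subseteq> {1..n}" for S
    proof -
      have "finite S" using that(2) finite_subset by blast
      then have "k \<le> card S" using J card_mono[OF _ that(1)] by blast
      then show ?thesis using * that(2) by blast
    qed
    then show "derivs J h x = 0" using derivs_fourier[of J n x h] J x by simp
  qed
qed

lemma is_high_part_iff:
  "is_high_part n k f g \<longleftrightarrow>
     g = restrict (\<lambda>x. \<Sum>S | S \<subseteq> {1..n} \<and> k \<le> card S. fourier n f S * walsh S x) (cube n)"
  (is "_ \<longleftrightarrow> g = ?g")
proof -
  let ?U = "{S. S \<subseteq> {1..n} \<and> k \<le> card S}"
  have diff: "fourier n (\<lambda>x. a x - b x) S = fourier n a S - fourier n b S" for a b S
    by (simp add: fourier_def cube_expectation_eq left_diff_distrib sum_subtractf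
        diff_divide_distrib)
  have null_diff: "(\<lambda>x. a x - b x) \<in> grad_null n k"
    if "(\<lambda>x. f x - a x) \<in> grad_null n k" "(\<lambda>x. f x - b x) \<in> grad_null n k" for a b
    using that unfolding grad_null_iff diff by simp
  have four: "fourier n ?g T = (if T \<in> ?U then fourier n f T else 0)" if "T \<subseteq> {1..n}" for T
    using that by (intro fourier_walsh_sum) auto
  have ex: "is_high_part n k f ?g"
    unfolding is_high_part_def
  proof (intro conjI ballI)
    show "?g \<in> extensional (cube n)" by simp
    show "(\<lambda>x. f x - ?g x) \<in> grad_null n k"
      unfolding grad_null_iff
    proof (intro allI impI)
      fix S assume "S \<subseteq> {1..n} \<and> k \<le> card S"
      then have "S \<subseteq> {1..n}" "S \<in> ?U" by blast+
      then have "fourier n ?g S = fourier n f S" by (simp only: four if_True)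
      then show "fourier n (\<lambda>x. f x - ?g x) S = 0" by (simp only: diff)
    qed
    fix h assume h: "h \<in> grad_null n k"
    have "fourier n ?g S * fourier n h S = 0" if "S \<in> Pow {1..n}" for S
    proof (cases "k \<le> card S")
      case True
      then have "fourier n h S = 0" using h that unfolding grad_null_iff by blast
      then show ?thesis by (simp only: mult_zero_right)
    next
      case False
      then have "S \<subseteq> {1..n}" "S \<notin> ?U" using that by blast+
      then have "fourier n ?g S = 0" by (simp only: four if_False)
      then show ?thesis by (simp only: mult_zero_left)
    qed
    then show "cube_expectation n (\<lambda>x. ?g x * h x) = 0"
      unfolding parseval by (intro sum.neutral ballI)
  qed
  have "g = ?g" if g: "is_high_part n k f g"
  proof -
    have 1: "(\<lambda>x. g x - ?g x) \<in> grad_null n k"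
    proof (rule null_diff)
      show "(\<lambda>x. f x - g x) \<in> grad_null n k" using g unfolding is_high_part_def by (elim conjE)
      show "(\<lambda>x. f x - ?g x) \<in> grad_null n k" using ex unfolding is_high_part_def by (elim conjE)
    qed
    have "cube_expectation n (\<lambda>x. (g x - ?g x) * (g x - ?g x)) =
        cube_expectation n (\<lambda>x. g x * (g x - ?g x)) - cube_expectation n (\<lambda>x. ?g x * (g x - ?g x))"
      by (simp only: cube_expectation_eq left_diff_distrib sum_subtractf diff_divide_distrib)
    also have "\<dots> = 0"
    proof -
      have "cube_expectation n (\<lambda>x. g x * (g x - ?g x)) = 0"
        using g 1 unfolding is_high_part_def by (elim conjE) (drule (1) bspec)
      moreover have "cube_expectation n (\<lambda>x. ?g x * (g x - ?g x)) = 0"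
        using ex 1 unfolding is_high_part_def by (elim conjE) (drule (1) bspec)
      ultimately show ?thesis by (simp only: diff_self)
    qed
    finally have "(\<Sum>x\<in>cube n. (g x - ?g x)\<^sup>2) = 0"
      by (simp add: cube_expectation_eq power2_eq_square)
    then have "\<forall>x\<in>cube n. (g x - ?g x)\<^sup>2 = 0"
      by (subst (asm) sum_nonneg_eq_0_iff) auto
    then have eq: "g x = ?g x" if "x \<in> cube n" for x using that by simp
    have "g \<in> extensional (cube n)" "?g \<in> extensional (cube n)"
      using g by (simp_all add: is_high_part_def)
    then show ?thesis by (rule extensionalityI) (rule eq)
  qed
  then show ?thesis using ex by (intro iffI) (assumption, simp only:)
qed

lemma ex1_high_part: "\<exists>!g. is_high_part n k f g"
  by (simp add: is_high_part_iff)

lemma high_weight_fourier: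
  "high_weight n k f = (\<Sum>S | S \<subseteq> {1..n} \<and> k \<le> card S. (fourier n f S)\<^sup>2)"
proof -
  let ?g = "high_part n k f"
  have g: "?g = restrict (\<lambda>x. \<Sum>S | S \<subseteq> {1..n} \<and> k \<le> card S. fourier n f S * walsh S x) (cube n)"
    by (simp add: high_part_def is_high_part_iff)
  have four: "fourier n ?g T = (if T \<in> {S. S \<subseteq> {1..n} \<and> k \<le> card S} then fourier n f T else 0)"
    if "T \<subseteq> {1..n}" for T
    using that g by (intro fourier_walsh_sum) auto
  have "high_weight n k f = cube_expectation n (\<lambda>x. ?g x * ?g x)"
    by (simp add: high_weight_def cube_norm_def cube_expectation_eq power2_eq_square
        powr_half_sqrt sum_nonneg)
  also have "\<dots> = (\<Sum>S\<in>Pow {1..n}. if k \<le> card S then (fourier n f S)\<^sup>2 else 0)"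
    unfolding parseval by (rule sum.cong) (auto simp: four power2_eq_square)
  also have "\<dots> = (\<Sum>S | S \<subseteq> {1..n} \<and> k \<le> card S. (fourier n f S)\<^sup>2)"
    by (rule sum.mono_neutral_cong_right) auto
  finally show ?thesis .
qed

lemma M_fun_0:
  assumes "1 \<le> p" "p \<le> 2"
  shows "((\<lambda>y. (1 - exp (- y)) / y powr (p / 2)) \<longlongrightarrow> (if p = 2 then 1 else 0)) (at_right (0::real))"
    and "M_fun p 0 = (if p = 2 then 1 else 0)"
proof -
  have lim1: "((\<lambda>y::real. (1 - exp (- y)) / y) \<longlongrightarrow> 1) (at_right 0)"
    by real_asymp
  have lim2: "((\<lambda>y::real. y powr (1 - p / 2)) \<longlongrightarrow> (if p = 2 then 1 else 0)) (at_right 0)"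
  proof (cases "p = 2")
    case True
    then show ?thesis
      by (auto intro!: tendsto_eventually simp: eventually_at_filter)
  next
    case False
    then have "0 < 1 - p / 2" using assms by simp
    then show ?thesis using False by simp real_asymp
  qed
  have "((\<lambda>y::real. (1 - exp (- y)) / y * y powr (1 - p / 2)) \<longlongrightarrow> 1 * (if p = 2 then 1 else 0))
      (at_right 0)"
    using lim1 lim2 by (rule tendsto_mult)
  moreover have "\<forall>\<^sub>F y in at_right (0::real).
      (1 - exp (- y)) / y * y powr (1 - p / 2) = (1 - exp (- y)) / y powr (p / 2)"
    using eventually_at_right_less by eventually_elim (simp add: powr_diff)
  ultimately show lim: "((\<lambda>y. (1 - exp (- y)) / y powr (p / 2)) \<longlongrightarrow> (if p = 2 then 1 else 0))
      (at_right (0::real))"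
    by (simp add: filterlim_cong)
  show "M_fun p 0 = (if p = 2 then 1 else 0)"
    using lim by (simp add: M_fun_def tendsto_Lim)
qed

lemma M_fun_attains_max:
  assumes p: "1 \<le> p" "p \<le> 2"
  shows "\<exists>x\<ge>0. \<forall>y\<ge>0. M_fun p y \<le> M_fun p x"
proof (cases "p = 2")
  case True
  have "(1 - exp (- y)) / y \<le> 1" if "0 < y" for y :: real
    using that exp_ge_add_one_self[of "- y"] by (simp add: field_simps)
  then have "M_fun p y \<le> M_fun p 0" if "0 \<le> y" for y
    using that True by (cases "y = 0") (auto simp: M_fun_0 M_fun_def[of 2 y])
  then show ?thesis by blast
next
  case False
  have e1: "0 < M_fun p 1" by (simp add: M_fun_def)
  have "0 < p / 2" using p by simp
  then have "((\<lambda>y::real. (1 - exp (- y)) / y powr (p / 2)) \<longlongrightarrow> 0) at_top"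
    by real_asymp
  then have "\<forall>\<^sub>F y in at_top. (1 - exp (- y)) / y powr (p / 2) < M_fun p 1"
    using e1 by (rule order_tendstoD)
  then obtain B where B: "\<And>y. B \<le> y \<Longrightarrow> (1 - exp (- y)) / y powr (p / 2) < M_fun p 1"
    by (auto simp: eventually_at_top_linorder)
  define b where "b = max B 1"
  have "{0..b} \<noteq> {}" by (simp add: b_def)
  have tail: "M_fun p y < M_fun p 1" if "b \<le> y" for y
    using that B[of y] by (simp add: b_def M_fun_def)
  have "continuous_on {0..b} (M_fun p)"
    unfolding continuous_on_def
  proof
    fix x assume "x \<in> {0..b}"
    show "(M_fun p \<longlongrightarrow> M_fun p x) (at x within {0..b})"
    proof (cases "x = 0")
      case True
      have "((\<lambda>y. (1 - exp (- y)) / y powr (p / 2)) \<longlongrightarrow> M_fun p 0) (at_right 0)"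
        using M_fun_0[OF p] by simp
      moreover have "\<forall>\<^sub>F y in at_right 0. (1 - exp (- y)) / y powr (p / 2) = M_fun p y"
        using eventually_at_right_less by eventually_elim (simp add: M_fun_def)
      ultimately have "(M_fun p \<longlongrightarrow> M_fun p 0) (at_right 0)"
        using Lim_transform_eventually by blast
      moreover have "at (0::real) within {0..b} = at_right 0"
        using at_within_Icc_at_right[of 0 b] by (simp add: b_def)
      ultimately show ?thesis using True by simp
    next
      case False
      with \<open>x \<in> {0..b}\<close> have x: "0 < x" by simp
      then have "((\<lambda>y. (1 - exp (- y)) / y powr (p / 2)) \<longlongrightarrow> M_fun p x) (at x)"
        by (auto simp: M_fun_def intro!: tendsto_eq_intros)
      moreover have "\<forall>\<^sub>F y in at x. (1 - exp (- y)) / y powr (p / 2) = M_fun p y"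
      proof -
        have "\<forall>\<^sub>F y in at x. y \<in> {0<..}"
          using x by (intro eventually_at_in_open') auto
        then show ?thesis by eventually_elim (simp add: M_fun_def)
      qed
      ultimately have "(M_fun p \<longlongrightarrow> M_fun p x) (at x)"
        using Lim_transform_eventually by blast
      then show ?thesis by (rule tendsto_within_subset) simp
    qed
  qed
  with \<open>{0..b} \<noteq> {}\<close> obtain x where x: "x \<in> {0..b}" "\<And>y. y \<in> {0..b} \<Longrightarrow> M_fun p y \<le> M_fun p x"
    using continuous_attains_sup[of "{0..b}" "M_fun p"] by fastforce
  have "M_fun p y \<le> M_fun p x" if "0 \<le> y" for y
  proof (cases "y \<le> b")
    case False
    then have "M_fun p y < M_fun p 1" by (intro tail) simp
    moreover have "M_fun p 1 \<le> M_fun p x" by (rule x(2)) (simp add: b_def)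
    ultimately show ?thesis by simp
  qed (use x(2) that in simp)
  then show ?thesis using x(1) by auto
qed

end

theory Submission
  imports Defs
begin

text \<open>
  Let \<open>g\<close> be the vector of derivatives of order \<open>k\<close> of \<open>f\<close>, let \<open>P\<^sub>\<rho>\<close> be the noise operator
  (the heat semigroup at time \<open>ln (1 / \<rho>)\<close>), write \<open>A = \<parallel>g\<parallel>\<^sub>p\<^sup>p\<close>, \<open>N = \<parallel>g\<parallel>\<^sub>q\<^sup>2\<close>, and let \<open>W\<close> be the
  weight of \<open>f\<close> at levels at least \<open>k\<close>. Put \<open>Q(s) = E \<bar>P\<^sub>\<rho> g\<bar>\<^sup>2\<close> with \<open>\<rho> = exp(-s/2)\<close>. On the Fourier
  side, \<open>Q(s)\<close> is the sum of \<open>(m choose k) exp(-(m-k)s)\<close> against the squared coefficients of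
  level \<open>m \<ge> k\<close>. Since the integral of \<open>(m choose k) exp(-(m-k)s)\<close> against the law of the maximum
  of \<open>k\<close> independent exponential variables is 1, \<open>W\<close> is the average of \<open>Q\<close> over that law. The
  maximum is distributed as a sum of independent exponential times of rates 1, ..., \<open>k\<close>, so
  the average can be taken one time at a time: this gives functions \<open>R\<^sub>0 = Q, R\<^sub>1, ..., R\<^sub>k\<close> with
  \<open>R\<^sub>k(0) = W\<close> (\<open>exp_sum\<close>).

  Two properties of \<open>Q\<close> enter. First, \<open>\<bar>f\<bar> \<le> 1\<close> forces \<open>\<bar>P\<^sub>\<rho> g\<bar>\<^sup>2 \<le> (1-\<rho>\<^sup>2)\<^bsup>-k\<^esup>\<close> at every point
  (\<open>smooth_grad_bounded\<close>); trading the power \<open>2-p\<close> of the gradient for this bound gives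
  \<open>Q(s) \<le> A (1-exp(-2s))\<^bsup>-k(1-p/2)\<^esup>\<close> (\<open>grad_energy_le\<close>). Second, hypercontractivity and
  interpolation of norms give \<open>Q(s+r) \<le> Q(s)\<^bsup>1-\<theta>\<^esup> N\<^bsup>\<theta>\<^esup>\<close> with \<open>\<theta> = q/(2-q) tanh(r/2)\<close>
  (\<open>grad_energy_decay\<close>). Young's inequality with reference value \<open>W\<close> makes the latter linear in
  \<open>Q\<close>, and in this form it is inherited by all the averages \<open>R\<^sub>j\<close> (\<open>decay\<close>).

  Let \<open>L = max (ln (W/N)) 0\<close>, \<open>\<alpha> = q/(2(2-q))\<close> and \<open>\<Lambda> = 1 + \<alpha>L/k\<close>. Restrict the exponential time
  of rate \<open>j\<close> to a window of length about \<open>x/(j+\<alpha>L)\<close>. By the decay of the \<open>R\<^sub>j\<close>, each restriction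
  keeps at least the fraction \<open>1-exp(-x)\<close> of \<open>W\<close> (\<open>window_ge\<close>). On the windows the first property of \<open>Q\<close> bounds
  what is left by a product of one-dimensional integrals (\<open>window_le\<close>). The outcome is
  \<open>(1-exp(-x))\<^bsup>k\<^esup> W \<le> A (2\<^bsup>p/2\<^esup>/p (x/\<Lambda>)\<^bsup>p/2\<^esup>)\<^bsup>k\<^esup>\<close> for \<open>0 < x \<le> 2(2-q)/q\<close>, \<open>x < 2\<close> (\<open>high_weight_le\<close>).
  The maximum that defines \<open>M(p)\<close> is located in this range of \<open>x\<close> (\<open>SUP_M_fun_le\<close>), so that
  \<open>M(p)\<^bsup>k\<^esup> \<Lambda>\<^bsup>kp/2\<^esup> W \<le> A\<close>. This is the desired inequality with \<open>W\<close> in place of \<open>A\<close> inside the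
  logarithm; since \<open>y ln (1/y) \<le> 1/e\<close>, replacing it costs the summand
  \<open>pq/(4e(2-q))\<close> of \<open>C(p,q)\<close> (\<open>replace_weight_in_log\<close>).

  The lower bound on \<open>C(p,q)\<close> is elementary, because \<open>M(p)\<close> is bounded away from 0.
\<close>

section \<open>Successive exponential averages of a sum of exponentials\<close>

text \<open>
  The sum for \<open>j + 1\<close> is the average of the sum for \<open>j\<close>, shifted by an exponential time of
  rate \<open>j + 1\<close>: the factor \<open>l / (d i + l)\<close> is the Laplace transform at \<open>d i\<close> of the exponential
  law of rate \<open>l\<close>.
\<close>

definition exp_sum :: "'a set \<Rightarrow> ('a \<Rightarrow> real) \<Rightarrow> ('a \<Rightarrow> nat) \<Rightarrow> nat \<Rightarrow> real \<Rightarrow> real" where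
  "exp_sum I c d j s =
     (\<Sum>i\<in>I. c i * (\<Prod>l=1..j. real l / (real (d i) + real l)) * exp (- (real (d i) * s)))"

text \<open>
  The averaging relation in differential form, which avoids integrals over the half-line.
\<close>

lemma DERIV_exp_sum:
  "(exp_sum I c d (Suc j) has_real_derivative
     real (Suc j) * (exp_sum I c d (Suc j) s - exp_sum I c d j s)) (at s)"
proof -
  define v where "v i = (\<Prod>l=1..j. real l / (real (d i) + real l))" for i
  have v: "(\<Prod>l=1..Suc j. real l / (real (d i) + real l)) =
      v i * (real (Suc j) / (real (d i) + real (Suc j)))" for i
    by (simp add: v_def)
  have eq: "- real (d i) * (c i * (v i * (real (Suc j) / (real (d i) + real (Suc j))))) =
      real (Suc j) * (c i * (v i * (real (Suc j) / (real (d i) + real (Suc j)))) - c i * v i)" for i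
    by (simp add: divide_simps) (simp add: algebra_simps)
  have "(exp_sum I c d (Suc j) has_real_derivative
      (\<Sum>i\<in>I. - real (d i) * (c i * (v i * (real (Suc j) / (real (d i) + real (Suc j))))) *
         exp (- (real (d i) * s)))) (at s)"
    unfolding exp_sum_def[abs_def] v by (rule DERIV_sum) (auto intro!: derivative_eq_intros)
  also have "(\<Sum>i\<in>I. - real (d i) * (c i * (v i * (real (Suc j) / (real (d i) + real (Suc j))))) *
         exp (- (real (d i) * s))) = real (Suc j) * (exp_sum I c d (Suc j) s - exp_sum I c d j s)"
    unfolding eq exp_sum_def v by (simp add: v_def sum_distrib_left sum_subtractf[symmetric]) (simp add: algebra_simps)
  finally show ?thesis .
qed

lemma continuous_on_exp_sum [continuous_intros]:
  assumes "continuous_on A f"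
  shows "continuous_on A (\<lambda>x. exp_sum I c d j (f x))"
  unfolding exp_sum_def by (intro continuous_intros assms)

lemma exp_sum_damped_tendsto_0:
  "((\<lambda>s. exp (- (real (Suc j) * s)) * exp_sum I c d i (s + r)) \<longlongrightarrow> 0) at_top"
proof -
  have "((\<lambda>s. exp (- (real (Suc j) * s)) * (K * exp (- (real n * (s + r))))) \<longlongrightarrow> 0) at_top"
    for K and n :: nat
  proof -
    have "((\<lambda>s. exp (- ((real (Suc j) + real n) * s)) * (K * exp (- (real n * r)))) \<longlongrightarrow> 0) at_top"
    proof -
      have "0 < real (Suc j) + real n" by simp
      then have "((\<lambda>s. exp (- ((real (Suc j) + real n) * s))) \<longlongrightarrow> 0) at_top" by real_asymp
      then show ?thesis by (rule tendsto_mult_left_zero)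
    qed
    then show ?thesis by (rule Lim_transform_eventually) (simp add: algebra_simps exp_add exp_diff exp_minus field_simps)
  qed
  then have "((\<lambda>s. \<Sum>l\<in>I. exp (- (real (Suc j) * s)) * ((c l * (\<Prod>m=1..i. real m / (real (d l) + real m))) * exp (- (real (d l) * (s + r))))) \<longlongrightarrow> 0) at_top"
    by (intro tendsto_null_sum) blast
  then show ?thesis by (simp add: exp_sum_def sum_distrib_left)
qed

text \<open>
  The part of the average that comes from exponential times at most \<open>t\<close>; by lack of memory, the
  remaining part is a damped copy of the average itself.
\<close>

lemma exp_sum_iterated_integral:
  assumes "0 \<le> t"
  shows "((\<lambda>r. real (Suc j) * exp (- (real (Suc j) * r)) * exp_sum I c d j (s + r)) has_integral
     exp_sum I c d (Suc j) s - exp (- (real (Suc j) * t)) * exp_sum I c d (Suc j) (s + t)) {0..t}"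
proof -
  let ?F = "\<lambda>r. - (exp (- (real (Suc j) * r)) * exp_sum I c d (Suc j) (s + r))"
  have "((\<lambda>r. real (Suc j) * exp (- (real (Suc j) * r)) * exp_sum I c d j (s + r)) has_integral
     ?F t - ?F 0) {0..t}"
  proof (rule fundamental_theorem_of_calculus)
    fix r assume "r \<in> {0..t}"
    have 1: "((\<lambda>r. exp_sum I c d (Suc j) (s + r)) has_real_derivative
      real (Suc j) * (exp_sum I c d (Suc j) (s + r) - exp_sum I c d j (s + r)) * 1) (at r)"
      by (rule DERIV_chain'[OF _ DERIV_exp_sum]) (auto intro!: derivative_eq_intros)
    have "(?F has_real_derivative real (Suc j) * exp (- (real (Suc j) * r)) * exp_sum I c d j (s + r)) (at r)"
      by (rule derivative_eq_intros 1 refl)+ (simp add: algebra_simps)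
    then show "(?F has_vector_derivative real (Suc j) * exp (- (real (Suc j) * r)) * exp_sum I c d j (s + r))
        (at r within {0..t})"
      using has_real_derivative_iff_has_vector_derivative has_vector_derivative_at_within by blast
  qed (use assms in auto)
  then show ?thesis by simp
qed

text \<open>
  Hypercontractivity produces \<open>tanh (r / 2)\<close>; the normalisation makes \<open>tau r\<close> agree with \<open>r\<close> to
  first order at 0.
\<close>

definition tau :: "real \<Rightarrow> real" where "tau r = 2 * tanh (r / 2)"

text \<open>
  The assumption is the linear form of \<open>Q(s+r) \<le> Q(s)\<^bsup>1-\<theta>\<^esup> N\<^bsup>\<theta>\<^esup>\<close>, where \<open>\<theta> = \<alpha> tau r\<close> and
  \<open>L = ln (W/N)\<close>: the right-hand side is \<open>exp(-\<theta>L) Q(s)\<^bsup>1-\<theta>\<^esup> W\<^bsup>\<theta>\<^esup>\<close>, and Young's inequality is applied to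
  the last two factors.
\<close>

locale decay =
  fixes I :: "'a set" and c :: "'a \<Rightarrow> real" and d :: "'a \<Rightarrow> nat" and \<alpha> L W :: real
  assumes \<alpha>: "0 \<le> \<alpha>" and L: "0 \<le> L" and W: "0 \<le> W"
    and decay0: "\<And>s r. 0 \<le> s \<Longrightarrow> 0 \<le> r \<Longrightarrow> \<alpha> * tau r \<le> 1 \<Longrightarrow>
      exp_sum I c d 0 (s + r) \<le>
        exp (- (\<alpha> * tau r * L)) * ((1 - \<alpha> * tau r) * exp_sum I c d 0 s + \<alpha> * tau r * W)"
begin

abbreviation R :: "nat \<Rightarrow> real \<Rightarrow> real" where "R \<equiv> exp_sum I c d"

text \<open>
  Averaging preserves an inequality that is linear in the sums. In differential form: the
  difference of the two sides, damped by \<open>exp(-(j+1)s)\<close>, is nonincreasing in \<open>s\<close> by the induction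
  hypothesis and tends to 0, so it is nonnegative.
\<close>

lemma decay:
  assumes "0 \<le> s" "0 \<le> r" "\<alpha> * tau r \<le> 1"
  shows "R j (s + r) \<le>
    exp (- (\<alpha> * tau r * L)) * ((1 - \<alpha> * tau r) * R j s + \<alpha> * tau r * W)"
  using assms(1)
proof (induction j arbitrary: s)
  case 0
  then show ?case using decay0 assms by blast
next
  case (Suc j)
  define \<theta> where "\<theta> = \<alpha> * tau r"
  define \<kappa> where "\<kappa> = exp (- (\<theta> * L))"
  define G where "G i s = exp (- (real (Suc j) * s)) *
      (\<kappa> * ((1 - \<theta>) * R i s + \<theta> * W) - R i (s + r))" for i s
  have D: "(G (Suc j) has_real_derivative - real (Suc j) * G j s) (at s)" for s
  proof -
    have 1: "((\<lambda>s. R (Suc j) (s + r)) has_real_derivative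
      real (Suc j) * (R (Suc j) (s + r) - R j (s + r)) * 1) (at s)"
      by (rule DERIV_chain'[OF _ DERIV_exp_sum]) (auto intro!: derivative_eq_intros)
    show ?thesis unfolding G_def[abs_def]
      by (rule derivative_eq_intros 1 DERIV_exp_sum refl)+ (simp add: algebra_simps)
  qed
  have le: "G (Suc j) u \<le> G (Suc j) s" if "s \<le> u" for u
  proof (rule DERIV_nonpos_imp_nonincreasing[OF that])
    fix x assume "s \<le> x" "x \<le> u"
    then have "0 \<le> G j x"
      using Suc.IH[of x] Suc.prems by (simp add: G_def \<theta>_def \<kappa>_def)
    then have "- real (Suc j) * G j x \<le> 0" by (simp add: mult_nonneg_nonneg del: of_nat_Suc)
    then show "\<exists>y. DERIV (G (Suc j)) x :> y \<and> y \<le> 0" using D by blast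
  qed
  have "(G (Suc j) \<longlongrightarrow> 0) at_top"
  proof -
    have e: "((\<lambda>s. exp (- (real (Suc j) * s))) \<longlongrightarrow> 0) at_top"
      using exp_sum_damped_tendsto_0[where I="{()}" and c="\<lambda>_. 1" and d="\<lambda>_. 0" and i=0 and j=j and r=0]
      by (simp add: exp_sum_def)
    have "((\<lambda>s. \<kappa> * (1 - \<theta>) * (exp (- (real (Suc j) * s)) * R (Suc j) (s + 0))
        + \<kappa> * \<theta> * W * exp (- (real (Suc j) * s))
        - exp (- (real (Suc j) * s)) * R (Suc j) (s + r)) \<longlongrightarrow> \<kappa> * (1 - \<theta>) * 0 + \<kappa> * \<theta> * W * 0 - 0) at_top"
      by (intro tendsto_intros exp_sum_damped_tendsto_0 e)
    then show ?thesis by (simp add: G_def[abs_def] algebra_simps)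
  qed
  then have "0 \<le> G (Suc j) s"
    by (rule tendsto_upperbound) (auto intro: le eventually_at_top_linorderI)
  then show ?case by (simp add: G_def \<theta>_def \<kappa>_def zero_le_mult_iff)
qed

end

text \<open>
  Averages of \<open>h\<close> in which the exponential time of rate \<open>j\<close> is restricted to \<open>[0, t j]\<close>.
\<close>

primrec window :: "(real \<Rightarrow> real) \<Rightarrow> (nat \<Rightarrow> real) \<Rightarrow> nat \<Rightarrow> real \<Rightarrow> real" where
  "window h t 0 = h"
| "window h t (Suc j) = (\<lambda>s. integral {0..t (Suc j)}
     (\<lambda>r. real (Suc j) * exp (- (real (Suc j) * r)) * window h t j (s + r)))"

lemma continuous_on_window:
  assumes "continuous_on UNIV h"
  shows "continuous_on UNIV (window h t j)"
proof (induction j)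
  case 0
  then show ?case using assms by simp
next
  case (Suc j)
  have "continuous_on UNIV (\<lambda>s. integral (cbox 0 (t (Suc j)))
     (\<lambda>r. real (Suc j) * exp (- (real (Suc j) * r)) * window h t j (s + r)))"
    by (rule integral_continuous_on_param)
      (auto simp: case_prod_unfold intro!: continuous_intros continuous_on_compose2[OF Suc])
  then show ?case by simp
qed

lemma window_has_integral:
  assumes "continuous_on UNIV h"
  shows "((\<lambda>r. real (Suc j) * exp (- (real (Suc j) * r)) * window h t j (s + r)) has_integral
    window h t (Suc j) s) {0..t (Suc j)}"
  unfolding window.simps
  by (intro integrable_integral integrable_continuous_interval continuous_intros
      continuous_on_compose2[OF continuous_on_window[OF assms]]) auto

context decay
begin

text \<open>
  Restricting the exponential time of rate \<open>j\<close> to \<open>[0, t j]\<close> discards \<open>exp(-j t\<^sub>j) R\<^sub>j(s + t\<^sub>j)\<close>, which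
  \<open>decay\<close> bounds by \<open>exp(-x)\<close> times a convex combination of \<open>R\<^sub>j(s)\<close> and \<open>W\<close>. Because \<open>R\<^sub>j(s)\<close> may be
  smaller than \<open>W\<close> when \<open>s > 0\<close>, the loss is not proportional to \<open>R\<^sub>j(s)\<close>; the constant \<open>b\<close> keeps
  track of the multiple of \<open>W\<close>. At the last stage and \<open>s = 0\<close> the bound becomes \<open>(a - b) W\<close>.
\<close>

lemma window_ge:
  assumes t: "\<And>j. 1 \<le> j \<Longrightarrow> 0 \<le> t j"
    and \<theta>: "\<And>j. 1 \<le> j \<Longrightarrow> 0 \<le> tau (t j)" "\<And>j. 1 \<le> j \<Longrightarrow> \<alpha> * tau (t j) \<le> 1"
    and x: "0 \<le> x" "\<And>j. 1 \<le> j \<Longrightarrow> x \<le> real j * t j + \<alpha> * tau (t j) * L"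
  shows "\<exists>a b. 0 \<le> a \<and> 0 \<le> b \<and> (1 - exp (- x)) ^ j \<le> a - b \<and>
    (\<forall>s\<ge>0. a * R j s - b * W \<le> window (R 0) t j s)"
proof (induction j)
  case 0
  show ?case by (rule exI[of _ 1], rule exI[of _ 0]) simp
next
  case (Suc j)
  then obtain a b where ab: "0 \<le> a" "0 \<le> b" "(1 - exp (- x)) ^ j \<le> a - b"
    "\<And>s. 0 \<le> s \<Longrightarrow> a * R j s - b * W \<le> window (R 0) t j s" by blast
  define u where "u = t (Suc j)"
  define \<theta>' where "\<theta>' = \<alpha> * tau u"
  define e where "e = exp (- (real (Suc j) * u))"
  \<comment> \<open>the factor lost at this stage\<close>
  define \<kappa> where "\<kappa> = e * exp (- (\<theta>' * L))"
  have u: "0 \<le> u" using t by (simp add: u_def)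
  have th: "0 \<le> \<theta>'" "\<theta>' \<le> 1" using \<theta>[of "Suc j"] \<alpha> by (auto simp: \<theta>'_def u_def)
  have e: "0 < e" "e \<le> 1" using u by (auto simp: e_def)
  have \<kappa>: "0 < \<kappa>" "\<kappa> \<le> e" using th L e by (auto simp: \<kappa>_def mult_le_cancel_left2)
  have \<kappa>x: "\<kappa> \<le> exp (- x)"
    using x(2)[of "Suc j"] by (simp add: \<kappa>_def e_def \<theta>'_def u_def flip: exp_add)
  define a' where "a' = a * (1 - \<kappa> * (1 - \<theta>'))"
  define b' where "b' = a * \<kappa> * \<theta>' + b * (1 - e)"
  have "\<kappa> * (1 - \<theta>') \<le> 1 * 1" using \<kappa> e th by (intro mult_mono) auto
  then have "0 \<le> a'" using ab by (simp add: a'_def)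
  moreover have "0 \<le> b'" using ab \<kappa> th e by (simp add: b'_def)
  moreover have "(1 - exp (- x)) ^ Suc j \<le> a' - b'"
  proof -
    \<comment> \<open>\<open>b\<close> is multiplied by \<open>1 - e\<close>, the mass of the window, which is at most \<open>1 - \<kappa>\<close>\<close>
    have "(1 - exp (- x)) ^ Suc j \<le> (1 - \<kappa>) * (a - b)"
    proof -
      have "0 \<le> (1 - exp (- x)) ^ j" using x by simp
      then show ?thesis using ab(3) \<kappa>x \<kappa>(2) e(2) x unfolding power_Suc by (intro mult_mono) auto
    qed
    also have "\<dots> = a * (1 - \<kappa>) - b * (1 - \<kappa>)" by (simp add: algebra_simps)
    also have "\<dots> \<le> a * (1 - \<kappa>) - b * (1 - e)"
      using \<kappa> ab by (simp add: mult_left_mono)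
    also have "\<dots> = a' - b'" by (simp add: a'_def b'_def algebra_simps)
    finally show ?thesis .
  qed
  moreover have "a' * R (Suc j) s - b' * W \<le> window (R 0) t (Suc j) s" if s: "0 \<le> s" for s
  proof -
    have int1: "((\<lambda>r. real (Suc j) * exp (- (real (Suc j) * r))) has_integral 1 - e) {0..u}"
      using exp_sum_iterated_integral[OF u, of j "{()}" "\<lambda>_. 1" "\<lambda>_. 0" s]
      by (simp add: exp_sum_def e_def)
    have "((\<lambda>r. a * (real (Suc j) * exp (- (real (Suc j) * r)) * R j (s + r)) -
        b * W * (real (Suc j) * exp (- (real (Suc j) * r)))) has_integral
        a * (R (Suc j) s - e * R (Suc j) (s + u)) - b * W * (1 - e)) {0..u}"
      unfolding e_def
      by (intro has_integral_diff has_integral_mult_right exp_sum_iterated_integral[OF u])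
        (use int1 in \<open>simp add: e_def\<close>)
    moreover have "((\<lambda>r. real (Suc j) * exp (- (real (Suc j) * r)) * window (R 0) t j (s + r))
        has_integral window (R 0) t (Suc j) s) {0..u}"
      unfolding u_def by (rule window_has_integral) (intro continuous_intros)
    ultimately have "a * (R (Suc j) s - e * R (Suc j) (s + u)) - b * W * (1 - e)
        \<le> window (R 0) t (Suc j) s"
    proof (rule has_integral_le)
      fix r assume "r \<in> {0..u}"
      then have "real (Suc j) * exp (- (real (Suc j) * r)) * (a * R j (s + r) - b * W) \<le>
          real (Suc j) * exp (- (real (Suc j) * r)) * window (R 0) t j (s + r)"
        using ab(4)[of "s + r"] s by (intro mult_left_mono) auto
      then show "a * (real (Suc j) * exp (- (real (Suc j) * r)) * R j (s + r)) -
          b * W * (real (Suc j) * exp (- (real (Suc j) * r)))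
          \<le> real (Suc j) * exp (- (real (Suc j) * r)) * window (R 0) t j (s + r)"
        by (simp add: algebra_simps)
    qed
    moreover have "a * (e * R (Suc j) (s + u)) \<le> a * (\<kappa> * ((1 - \<theta>') * R (Suc j) s + \<theta>' * W))"
      using decay[OF s u, of "Suc j"] th e ab unfolding \<kappa>_def \<theta>'_def mult.assoc
      by (intro mult_left_mono) auto
    ultimately show ?thesis by (simp add: a'_def b'_def algebra_simps)
  qed
  ultimately show ?case by blast
qed

end

section \<open>Truncated averages of a function with a singularity at 0\<close>

lemma tau_nonneg: "0 \<le> r \<Longrightarrow> 0 \<le> tau r" by (simp add: tau_def)

lemma tau_eq: "tau r = 2 * (1 - exp (- r)) / (1 + exp (- r))"
  by (simp add: tau_def tanh_real_altdef)

lemma DERIV_tau: "(tau has_real_derivative 1 - (tau r)\<^sup>2 / 4) (at r)"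
  unfolding tau_def[abs_def]
  by (auto intro!: derivative_eq_intros simp: power2_eq_square field_simps)

lemma tau_le: "0 \<le> r \<Longrightarrow> tau r \<le> r"
proof -
  assume r: "0 \<le> r"
  have "(\<lambda>x. x - tau x) 0 \<le> (\<lambda>x. x - tau x) r"
  proof (rule DERIV_nonneg_imp_nondecreasing[OF r])
    fix x :: real
    have "((\<lambda>x. x - tau x) has_real_derivative 1 - (1 - (tau x)\<^sup>2 / 4)) (at x)"
      by (rule DERIV_diff[OF DERIV_ident DERIV_tau])
    then show "\<exists>y. ((\<lambda>x. x - tau x) has_real_derivative y) (at x) \<and> 0 \<le> y"
      by (intro exI conjI) (assumption, simp)
  qed
  then show ?thesis by (simp add: tau_def)
qed

lemma tau_surj: 
  assumes "0 \<le> y" "y < 2"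
  obtains r where "0 \<le> r" "tau r = y"
proof
  let ?u = "(2 - y) / (2 + y)"
  have u: "0 < ?u" "?u \<le> 1" using assms by (auto simp: field_simps)
  show "0 \<le> - ln ?u" using u by simp
  show "tau (- ln ?u) = y"
    using assms u by (simp add: tau_eq field_simps)
qed

text \<open>
  With \<open>u = exp(-r)\<close> the right-hand side exceeds the left-hand side by the factor
  \<open>((1+u)\<^sup>2/4)\<^bsup>\<delta>-1\<^esup>\<close>. The right-hand side is the derivative of a power of \<open>tau\<close>, so it
  has an explicit integral in terms of the time change that hypercontractivity dictates.
\<close>

lemma kernel_le_tau:
  assumes r: "0 < r" and \<delta>: "\<delta> \<le> 1"
  shows "exp (- r) * (1 - exp (- 2 * r)) powr (- \<delta>) \<le>
    (2 * tau r) powr (- \<delta>) * (1 - (tau r)\<^sup>2 / 4)"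
proof -
  define u where "u = exp (- r)"
  have u: "0 < u" "u < 1" using r by (auto simp: u_def)
  have "exp (- 2 * r) = u\<^sup>2" by (simp add: u_def power2_eq_square flip: exp_add)
  then have 1: "1 - exp (- 2 * r) = (2 * tau r) * ((1 + u)\<^sup>2 / 4)"
    using u unfolding tau_eq u_def[symmetric] by (simp add: power2_eq_square field_simps)
  have 2: "1 - (tau r)\<^sup>2 / 4 = u / ((1 + u)\<^sup>2 / 4)"
  proof -
    have "1 + u \<noteq> 0" using u by simp
    then show ?thesis
      unfolding tau_eq u_def[symmetric]
      by (simp add: divide_simps) (simp add: power2_eq_square algebra_simps)
  qed
  let ?g = "(1 + u)\<^sup>2 / 4"
  have "(1 + u)\<^sup>2 \<le> 2\<^sup>2" using u by (intro power_mono) auto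
  then have g: "0 < ?g" "?g \<le> 1" using u by auto
  have t: "0 < tau r" using u unfolding tau_eq u_def[symmetric] by simp
  have "?g powr (- \<delta>) \<le> ?g powr (-1)"
    using g \<delta> by (intro powr_mono') auto
  also have "\<dots> = 1 / ?g" using g by (simp add: powr_minus_divide)
  finally have "(2 * tau r) powr (- \<delta>) * (u * ?g powr (- \<delta>)) \<le> (2 * tau r) powr (- \<delta>) * (u * (1 / ?g))"
    using u by (intro mult_left_mono) auto
  moreover have "(1 - exp (- 2 * r)) powr (- \<delta>) = (2 * tau r) powr (- \<delta>) * ?g powr (- \<delta>)"
    unfolding 1 by (rule powr_mult)
  ultimately show ?thesis
    unfolding 2 u_def[symmetric] by (simp add: mult_ac)
qed

lemma has_integral_tau_powr:
  assumes t: "0 \<le> t" and \<delta>: "0 \<le> \<delta>" "\<delta> < 1"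
  shows "((\<lambda>r. (2 * tau r) powr (- \<delta>) * (1 - (tau r)\<^sup>2 / 4)) has_integral
    2 powr (- \<delta>) / (1 - \<delta>) * tau t powr (1 - \<delta>)) {0..t}"
proof -
  let ?F = "\<lambda>r. 2 powr (- \<delta>) / (1 - \<delta>) * tau r powr (1 - \<delta>)"
  have "((\<lambda>r. (2 * tau r) powr (- \<delta>) * (1 - (tau r)\<^sup>2 / 4)) has_integral ?F t - ?F 0) {0..t}"
  proof (rule fundamental_theorem_of_calculus_interior[where f = ?F, OF t])
    have "continuous_on {0..t} tau"
      by (rule DERIV_continuous_on) (rule has_field_derivative_at_within[OF DERIV_tau])
    then show "continuous_on {0..t} ?F"
      using \<delta> by (intro continuous_on_mult continuous_on_const continuous_on_powr') (auto simp: tau_nonneg)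
  next
    fix r assume "r \<in> {0<..<t}"
    then have t: "0 < tau r" by (simp add: tau_def)
    have "(?F has_real_derivative 2 powr (- \<delta>) / (1 - \<delta>) *
        ((1 - \<delta>) * tau r powr (1 - \<delta> - of_nat 1) * (1 - (tau r)\<^sup>2 / 4))) (at r)"
      by (intro DERIV_cmult DERIV_fun_powr DERIV_tau t)
    also have "2 powr (- \<delta>) / (1 - \<delta>) *
        ((1 - \<delta>) * tau r powr (1 - \<delta> - of_nat 1) * (1 - (tau r)\<^sup>2 / 4)) =
        (2 * tau r) powr (- \<delta>) * (1 - (tau r)\<^sup>2 / 4)"
      using \<delta> t by (simp add: powr_mult)
    finally have "(?F has_real_derivative (2 * tau r) powr (- \<delta>) * (1 - (tau r)\<^sup>2 / 4)) (at r)" .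
    then show "(?F has_vector_derivative (2 * tau r) powr (- \<delta>) * (1 - (tau r)\<^sup>2 / 4)) (at r)"
      by (simp add: has_real_derivative_iff_has_vector_derivative)
  qed
  moreover have "tau 0 = 0" by (simp add: tau_def)
  ultimately show ?thesis by simp
qed

text \<open>
  Splits off one time from a sum of times. With \<open>A = 1-exp(-2s)\<close> and \<open>B = exp(-2s)(1-exp(-2r))\<close>,
  Bernoulli's inequality gives \<open>(A+B)\<^bsup>n+1\<^esup> \<ge> (n+1) A\<^bsup>n\<^esup> B\<close>.
\<close>

lemma one_minus_exp_sum_powr_le:
  fixes s r \<delta> :: real and n :: nat
  assumes "0 < s" "0 < r" "0 \<le> \<delta>"
  shows "(1 - exp (- 2 * (s + r))) powr (- (real (Suc n) * \<delta>)) \<le>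
    real (Suc n) powr (- \<delta>) * exp (2 * \<delta> * s) * (1 - exp (- 2 * s)) powr (- (real n * \<delta>)) *
      (1 - exp (- 2 * r)) powr (- \<delta>)"
proof -
  define A where "A = 1 - exp (- 2 * s)"
  define C where "C = 1 - exp (- 2 * r)"
  define B where "B = exp (- 2 * s) * C"
  have pos: "0 < A" "0 < C" "0 < B" using assms by (auto simp: A_def C_def B_def)
  have AB: "1 - exp (- 2 * (s + r)) = A + B"
    by (simp add: A_def B_def C_def algebra_simps flip: exp_add)
  have "1 + real (Suc n) * (B / A) \<le> (1 + B / A) ^ Suc n"
    by (rule Bernoulli_inequality) (use pos in \<open>smt (verit) divide_pos_pos\<close>)
  then have "real (Suc n) * (B / A) \<le> (1 + B / A) ^ Suc n" by linarith
  then have "A ^ Suc n * (real (Suc n) * (B / A)) \<le> A ^ Suc n * (1 + B / A) ^ Suc n"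
    using pos by (intro mult_left_mono) auto
  also have "\<dots> = (A + B) ^ Suc n"
  proof -
    have "A * (1 + B / A) = A + B" using pos by (simp add: field_simps)
    then show ?thesis by (simp only: flip: power_mult_distrib)
  qed
  also have "A ^ Suc n * (real (Suc n) * (B / A)) = real (Suc n) * A ^ n * B"
    using pos by simp
  finally have "real (Suc n) * A ^ n * B \<le> (A + B) ^ Suc n" .
  then have "((A + B) ^ Suc n) powr (- \<delta>) \<le> (real (Suc n) * A ^ n * B) powr (- \<delta>)"
    using assms pos by (intro powr_mono2') (auto simp del: power_Suc of_nat_Suc)
  moreover have "((A + B) ^ Suc n) powr (- \<delta>) = (A + B) powr (- (real (Suc n) * \<delta>))"
    using pos by (simp add: powr_realpow[symmetric] powr_powr del: power_Suc of_nat_Suc)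
  moreover have "(real (Suc n) * A ^ n * B) powr (- \<delta>) =
      real (Suc n) powr (- \<delta>) * exp (2 * \<delta> * s) * A powr (- (real n * \<delta>)) * C powr (- \<delta>)"
  proof -
    have "exp (- 2 * s) powr (- \<delta>) = exp (2 * \<delta> * s)" by (simp add: powr_def mult_ac)
    then show ?thesis
      using pos by (simp add: B_def powr_mult powr_realpow[symmetric] powr_powr del: of_nat_Suc)
  qed
  ultimately show ?thesis by (simp only: AB A_def C_def)
qed

text \<open>
  The singularity of order \<open>k\<delta>\<close> at 0 is shared among the \<open>k\<close> times: every stage lowers the
  order by \<open>\<delta>\<close> and leaves a singularity of order \<open>\<delta> < 1\<close> in its own time, which is
  integrable. The growth \<open>exp (2 i \<delta> s)\<close> that accumulates is absorbed at the next stage by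
  the exponential density, as \<open>2\<delta> \<le> 1\<close>.
\<close>

lemma window_le:
  fixes h :: "real \<Rightarrow> real"
  assumes cont: "continuous_on UNIV h"
    and h: "\<And>s. 0 < s \<Longrightarrow> h s \<le> B * (1 - exp (- 2 * s)) powr (- (real k * \<delta>))"
    and B: "0 \<le> B" and \<delta>: "0 \<le> \<delta>" "\<delta> \<le> 1 / 2" and t: "\<And>j. 1 \<le> j \<Longrightarrow> 0 \<le> t j"
    and i: "i \<le> k" and s: "0 < s"
  shows "window h t i s \<le>
    B * (\<Prod>j=1..i. real j * real (k + 1 - j) powr (- \<delta>) * (2 powr (- \<delta>) / (1 - \<delta>) * tau (t j) powr (1 - \<delta>))) *
      exp (2 * real i * \<delta> * s) * (1 - exp (- 2 * s)) powr (- (real (k - i) * \<delta>))"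
  using i s
proof (induction i arbitrary: s)
  case 0
  then show ?case using h[of s] by simp
next
  case (Suc i)
  define K where "K = B * (\<Prod>j=1..i. real j * real (k + 1 - j) powr (- \<delta>) * (2 powr (- \<delta>) / (1 - \<delta>) * tau (t j) powr (1 - \<delta>)))"
  have K: "0 \<le> K" unfolding K_def using B \<delta> by (intro mult_nonneg_nonneg prod_nonneg) auto
  define n where "n = k - Suc i"
  have n: "k - i = Suc n" "k + 1 - Suc i = Suc n" using Suc.prems by (auto simp: n_def)
  define u where "u = t (Suc i)"
  have u: "0 \<le> u" using t by (simp add: u_def)
  define D where "D = real (Suc i) * (real (Suc n) powr (- \<delta>) * (K * (exp (2 * real (Suc i) * \<delta> * s) *
      (1 - exp (- 2 * s)) powr (- (real n * \<delta>)))))"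
  have D: "0 \<le> D" using K by (simp add: D_def)
  define f where "f = (\<lambda>r. real (Suc i) * exp (- (real (Suc i) * r)) * window h t i (s + r))"
  define g where "g = (\<lambda>r. D * ((2 * tau r) powr (- \<delta>) * (1 - (tau r)\<^sup>2 / 4)))"
  have f: "(f has_integral window h t (Suc i) s) {0..u}"
    unfolding u_def f_def by (rule window_has_integral[OF cont])
  have g: "(g has_integral D * (2 powr (- \<delta>) / (1 - \<delta>) * tau u powr (1 - \<delta>))) {0..u}"
    unfolding g_def by (intro has_integral_mult_right has_integral_tau_powr) (use u \<delta> in auto)
  have fg: "f r \<le> g r" if r: "0 < r" for r
  proof -
    have "f r \<le> real (Suc i) * exp (- (real (Suc i) * r)) *
        (K * exp (2 * real i * \<delta> * (s + r)) * (1 - exp (- 2 * (s + r))) powr (- (real (k - i) * \<delta>)))"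
      unfolding f_def K_def using Suc.IH[of "s + r"] Suc.prems r by (intro mult_left_mono) auto
    also have "\<dots> \<le> real (Suc i) * exp (- (real (Suc i) * r)) *
        (K * exp (2 * real i * \<delta> * (s + r)) * (real (Suc n) powr (- \<delta>) * exp (2 * \<delta> * s) *
          (1 - exp (- 2 * s)) powr (- (real n * \<delta>)) * (1 - exp (- 2 * r)) powr (- \<delta>)))"
      unfolding n(1) using Suc.prems r \<delta> K
      by (intro mult_left_mono one_minus_exp_sum_powr_le mult_nonneg_nonneg) auto
    also have "\<dots> = D * (exp (2 * real i * \<delta> * r - real (Suc i) * r) * (1 - exp (- 2 * r)) powr (- \<delta>))"
    proof -
      have 1: "exp (2 * real i * \<delta> * (s + r)) * exp (2 * \<delta> * s) =
          exp (2 * real (Suc i) * \<delta> * s) * exp (2 * real i * \<delta> * r)"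
        by (simp add: algebra_simps flip: exp_add)
      have 2: "exp (2 * real i * \<delta> * r - real (Suc i) * r) =
          exp (2 * real i * \<delta> * r) * exp (- (real (Suc i) * r))"
        by (simp flip: exp_add)
      have "real (Suc i) * exp (- (real (Suc i) * r)) *
        (K * exp (2 * real i * \<delta> * (s + r)) * (real (Suc n) powr (- \<delta>) * exp (2 * \<delta> * s) *
          (1 - exp (- 2 * s)) powr (- (real n * \<delta>)) * (1 - exp (- 2 * r)) powr (- \<delta>))) =
        real (Suc i) * exp (- (real (Suc i) * r)) *
        (K * (exp (2 * real i * \<delta> * (s + r)) * exp (2 * \<delta> * s)) * real (Suc n) powr (- \<delta>) *
          (1 - exp (- 2 * s)) powr (- (real n * \<delta>)) * (1 - exp (- 2 * r)) powr (- \<delta>))"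
        by (simp only: mult_ac)
      also have "\<dots> = D * (exp (2 * real i * \<delta> * r - real (Suc i) * r) * (1 - exp (- 2 * r)) powr (- \<delta>))"
        unfolding 1 2 D_def by (simp only: mult_ac)
      finally show ?thesis .
    qed
    also have "\<dots> \<le> D * (exp (- r) * (1 - exp (- 2 * r)) powr (- \<delta>))"
    proof -
      have "2 * real i * \<delta> * r \<le> 2 * real i * (1 / 2) * r"
        using \<delta> r by (intro mult_right_mono mult_left_mono) auto
      then have "2 * real i * \<delta> * r - real (Suc i) * r \<le> - r" by (simp add: algebra_simps)
      then show ?thesis using D by (intro mult_left_mono mult_right_mono) auto
    qed
    also have "\<dots> \<le> g r"
      unfolding g_def using D kernel_le_tau[OF r, of \<delta>] \<delta> by (intro mult_left_mono) auto
    finally show ?thesis .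
  qed
  \<comment> \<open>\<open>g\<close> vanishes at 0 because \<open>0 powr a = 0\<close>, so the comparison fails at this one point\<close>
  have "((\<lambda>r. if r = 0 then f 0 else g r) has_integral
      D * (2 powr (- \<delta>) / (1 - \<delta>) * tau u powr (1 - \<delta>))) {0..u}"
    by (rule has_integral_spike_finite[OF _ _ g, of "{0}"]) auto
  then have "window h t (Suc i) s \<le> D * (2 powr (- \<delta>) / (1 - \<delta>) * tau u powr (1 - \<delta>))"
    by (rule has_integral_le[OF f]) (use fg in auto)
  also have "\<dots> = B * (\<Prod>j=1..Suc i. real j * real (k + 1 - j) powr (- \<delta>) * (2 powr (- \<delta>) / (1 - \<delta>) * tau (t j) powr (1 - \<delta>))) *
      exp (2 * real (Suc i) * \<delta> * s) * (1 - exp (- 2 * s)) powr (- (real (k - Suc i) * \<delta>))"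
  proof -
    have "B * (\<Prod>j=1..Suc i. real j * real (k + 1 - j) powr (- \<delta>) * (2 powr (- \<delta>) / (1 - \<delta>) * tau (t j) powr (1 - \<delta>)))
      = K * (real (Suc i) * real (Suc n) powr (- \<delta>) * (2 powr (- \<delta>) / (1 - \<delta>) * tau u powr (1 - \<delta>)))"
      unfolding K_def u_def n(2)[symmetric] by (simp add: mult_ac)
    then show ?thesis unfolding D_def n_def[symmetric] by (simp only: mult_ac)
  qed
  finally show ?case .
qed

context decay
begin

text \<open>
  The window for rate \<open>j\<close> is chosen such that \<open>tau (t j) = x / (j + \<alpha> * L)\<close>; as \<open>tau r \<le> r\<close>, the
  exponent \<open>j * t j + \<alpha> * tau (t j) * L\<close> is then at least \<open>x\<close>. The factor \<open>j\<close> of the density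
  combines with the window to \<open>j x / (j + \<alpha> L)\<close>, which is largest for \<open>j = k\<close>.
\<close>

theorem weight_le:
  assumes k: "1 \<le> k" and x: "0 < x" "x < 2" "\<alpha> * x \<le> 1"
    and B: "0 \<le> B" and \<delta>: "0 \<le> \<delta>" "\<delta> \<le> 1 / 2"
    and bound: "\<And>s. 0 < s \<Longrightarrow> R 0 s \<le> B * (1 - exp (- 2 * s)) powr (- (real k * \<delta>))"
    and Wk: "W = R k 0"
  shows "(1 - exp (- x)) ^ k * W \<le>
    B * (2 powr (- \<delta>) / (1 - \<delta>) * (x / (1 + \<alpha> * L / real k)) powr (1 - \<delta>)) ^ k"
proof -
  have "\<exists>r\<ge>0. tau r = x / (real j + \<alpha> * L)" if "1 \<le> j" for j :: nat
  proof -
    have 1: "1 \<le> real j + \<alpha> * L" using that \<alpha> L by (simp add: add_increasing2)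
    then have "x / (real j + \<alpha> * L) \<le> x / 1" using x by (intro divide_left_mono) auto
    then have "x / (real j + \<alpha> * L) < 2" "0 \<le> x / (real j + \<alpha> * L)" using x 1 by auto
    then obtain r where "0 \<le> r" "tau r = x / (real j + \<alpha> * L)" using tau_surj by blast
    then show ?thesis by blast
  qed
  then obtain t where t: "\<And>j. 1 \<le> j \<Longrightarrow> 0 \<le> t j"
    and tau: "\<And>j. 1 \<le> j \<Longrightarrow> tau (t j) = x / (real j + \<alpha> * L)" by metis
  have pos: "1 \<le> real j + \<alpha> * L" if "1 \<le> j" for j :: nat
    using that \<alpha> L by (simp add: add_increasing2)
  have tau_nn: "0 \<le> tau (t j)" if "1 \<le> j" for j using tau_nonneg t that by blast
  have tau_x: "tau (t j) \<le> x" if "1 \<le> j" for j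
    using pos[OF that] x by (simp add: tau[OF that] divide_le_eq mult_le_cancel_left1)
  obtain a b where ab: "(1 - exp (- x)) ^ k \<le> a - b" "\<And>s. 0 \<le> s \<Longrightarrow> a * R k s - b * W \<le> window (R 0) t k s"
  proof -
    have "\<exists>a b. 0 \<le> a \<and> 0 \<le> b \<and> (1 - exp (- x)) ^ k \<le> a - b \<and>
      (\<forall>s\<ge>0. a * R k s - b * W \<le> window (R 0) t k s)"
    proof (rule window_ge)
      fix j :: nat assume j: "1 \<le> j"
      show "0 \<le> t j" "0 \<le> tau (t j)" using t tau_nn j by auto
      show "\<alpha> * tau (t j) \<le> 1" using mult_left_mono[OF tau_x[OF j] \<alpha>] x by simp
      have "x = (real j + \<alpha> * L) * tau (t j)"
        using pos[OF j] by (simp add: tau[OF j])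
      also have "\<dots> = real j * tau (t j) + \<alpha> * tau (t j) * L" by (simp add: algebra_simps)
      also have "\<dots> \<le> real j * t j + \<alpha> * tau (t j) * L"
        using tau_le[OF t[OF j]] by (simp add: mult_left_mono)
      finally show "x \<le> real j * t j + \<alpha> * tau (t j) * L" .
    qed (use x in auto)
    then show ?thesis using that by blast
  qed
  define \<beta> where "\<beta> = 2 powr (- \<delta>) / (1 - \<delta>)"
  have \<beta>: "0 \<le> \<beta>" using \<delta> by (simp add: \<beta>_def)
  define K where "K = B * (\<Prod>j=1..k. real j * real (k + 1 - j) powr (- \<delta>) * (\<beta> * tau (t j) powr (1 - \<delta>)))"
  have cont: "continuous_on UNIV (R 0)" by (intro continuous_intros)
  have "window (R 0) t k 0 \<le> K"
  proof -
    have "window (R 0) t k s \<le> K * exp (2 * real k * \<delta> * s)" if "0 < s" for s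
      using window_le[OF cont bound B \<delta> t order_refl that] that by (simp add: K_def \<beta>_def)
    moreover have "((\<lambda>s. K * exp (2 * real k * \<delta> * s)) \<longlongrightarrow> K * exp (2 * real k * \<delta> * 0)) (at_right 0)"
      by (intro tendsto_intros)
    moreover have "(window (R 0) t k \<longlongrightarrow> window (R 0) t k 0) (at_right 0)"
      using continuous_on_window[OF cont, of t k]
      by (simp add: continuous_on_eq_continuous_at isCont_def filterlim_at_split)
    ultimately have "window (R 0) t k 0 \<le> K * exp (2 * real k * \<delta> * 0)"
      by (intro tendsto_le[OF trivial_limit_at_right_real])
        (assumption, assumption, intro eventually_mono[OF eventually_at_right_less], blast)
    then show ?thesis by simp
  qed
  moreover have "(1 - exp (- x)) ^ k * W \<le> window (R 0) t k 0"
  proof -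
    have "(1 - exp (- x)) ^ k * W \<le> (a - b) * W" using ab W by (intro mult_right_mono) auto
    also have "\<dots> \<le> window (R 0) t k 0" using ab(2)[of 0] Wk by (simp add: algebra_simps)
    finally show ?thesis .
  qed
  moreover have "K \<le> B * (\<beta> * (x / (1 + \<alpha> * L / real k)) powr (1 - \<delta>)) ^ k"
  proof -
    have rev: "(\<Prod>j=1..k. real (k + 1 - j) powr (- \<delta>)) = (\<Prod>j=1..k. real j powr (- \<delta>))"
      by (rule prod.reindex_bij_witness[of _ "\<lambda>j. k + 1 - j" "\<lambda>j. k + 1 - j"]) auto
    have "(\<Prod>j=1..k. real j * real (k + 1 - j) powr (- \<delta>) * (\<beta> * tau (t j) powr (1 - \<delta>))) =
        (\<Prod>j=1..k. real j) * (\<Prod>j=1..k. real (k + 1 - j) powr (- \<delta>)) * (\<Prod>j=1..k. \<beta> * tau (t j) powr (1 - \<delta>))"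
      by (simp only: prod.distrib)
    also have "\<dots> = (\<Prod>j=1..k. real j * real j powr (- \<delta>) * (\<beta> * tau (t j) powr (1 - \<delta>)))"
      by (simp only: prod.distrib rev)
    also have "\<dots> \<le> (\<Prod>j=1..k. \<beta> * (x / (1 + \<alpha> * L / real k)) powr (1 - \<delta>))"
    proof (rule prod_mono, intro conjI)
      fix j assume "j \<in> {1..k}"
      then have j: "1 \<le> j" "j \<le> k" by auto
      show "0 \<le> real j * real j powr (- \<delta>) * (\<beta> * tau (t j) powr (1 - \<delta>))" using \<beta> by simp
      have "real j * real j powr (- \<delta>) = real j powr (1 - \<delta>)"
        using j by (simp add: powr_diff powr_minus field_simps)
      then have "real j * real j powr (- \<delta>) * (\<beta> * tau (t j) powr (1 - \<delta>)) =
          \<beta> * (real j * tau (t j)) powr (1 - \<delta>)"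
        using j tau_nn by (simp add: powr_mult)
      also have "\<dots> \<le> \<beta> * (x / (1 + \<alpha> * L / real k)) powr (1 - \<delta>)"
      proof (intro mult_left_mono powr_mono2 \<beta>)
        have aL: "0 \<le> \<alpha> * L" using \<alpha> L by simp
        have "real j * (1 + \<alpha> * L / real k) \<le> real j + \<alpha> * L"
        proof -
          have "real j / real k * (\<alpha> * L) \<le> 1 * (\<alpha> * L)"
            using j k aL by (intro mult_right_mono) auto
          then show ?thesis by (simp add: algebra_simps)
        qed
        moreover have "0 < 1 + \<alpha> * L / real k" using aL by (simp add: add_pos_nonneg)
        moreover have "real j * (x / b) \<le> x / a" if "0 < a" "0 < b" "real j * a \<le> b" for a b
          using that mult_left_mono[OF that(3), of x] x by (simp add: field_simps)
        ultimately show "real j * tau (t j) \<le> x / (1 + \<alpha> * L / real k)"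
          using pos[OF j(1)] unfolding tau[OF j(1)] by simp
      qed (use \<delta> tau_nn j in auto)
      finally show "real j * real j powr (- \<delta>) * (\<beta> * tau (t j) powr (1 - \<delta>)) \<le>
          \<beta> * (x / (1 + \<alpha> * L / real k)) powr (1 - \<delta>)" .
    qed
    finally show ?thesis unfolding K_def using B by (simp add: mult_left_mono)
  qed
  ultimately show ?thesis unfolding \<beta>_def by linarith
qed

end

section \<open>The noise operator\<close>

text \<open>
  On the cube this is the average of \<open>h\<close> over the two values of coordinate \<open>i\<close>, the current value
  having probability \<open>(1 + \<rho>) / 2\<close>. Off the cube the affine extension in \<open>x i\<close> is used.
\<close>

definition noise1 :: "real \<Rightarrow> nat \<Rightarrow> ((nat \<Rightarrow> real) \<Rightarrow> real) \<Rightarrow> (nat \<Rightarrow> real) \<Rightarrow> real" where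
  "noise1 \<rho> i h x = (1 + \<rho> * x i) / 2 * h (x(i := 1)) + (1 - \<rho> * x i) / 2 * h (x(i := -1))"

primrec noise :: "real \<Rightarrow> nat \<Rightarrow> ((nat \<Rightarrow> real) \<Rightarrow> real) \<Rightarrow> (nat \<Rightarrow> real) \<Rightarrow> real" where
  "noise \<rho> 0 h = h"
| "noise \<rho> (Suc n) h = noise \<rho> n (noise1 \<rho> (Suc n) h)"

lemma cube_coord: "x \<in> cube n \<Longrightarrow> i \<in> {1..n} \<Longrightarrow> x i = 1 \<or> x i = -1"
  unfolding cube_def by (drule (1) PiE_mem) auto

lemma cube_abs: "x \<in> cube n \<Longrightarrow> i \<in> {1..n} \<Longrightarrow> \<bar>x i\<bar> = 1"
  using cube_coord by fastforce

lemma noise_linear: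
  "noise \<rho> n (\<lambda>x. a * g x + b * h x) x = a * noise \<rho> n g x + b * noise \<rho> n h x"
proof (induction n arbitrary: g h)
  case 0
  then show ?case by simp
next
  case (Suc n)
  have "noise1 \<rho> (Suc n) (\<lambda>x. a * g x + b * h x) =
      (\<lambda>x. a * noise1 \<rho> (Suc n) g x + b * noise1 \<rho> (Suc n) h x)"
    by (auto simp: noise1_def algebra_simps add_divide_distrib diff_divide_distrib)
  then show ?case using Suc by simp
qed

lemma noise_add: "noise \<rho> n (\<lambda>x. g x + h x) x = noise \<rho> n g x + noise \<rho> n h x"
  using noise_linear[of \<rho> n 1 g 1 h] by simp

lemma noise_cmult: "noise \<rho> n (\<lambda>x. a * g x) x = a * noise \<rho> n g x"
  using noise_linear[of \<rho> n a g 0 g] by simp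

lemma noise_zero: "noise \<rho> n (\<lambda>x. 0) x = 0"
  using noise_cmult[of \<rho> n 0 "\<lambda>x. 0" x] by simp

lemma noise_sum: "noise \<rho> n (\<lambda>x. \<Sum>j\<in>T. a j * g j x) x = (\<Sum>j\<in>T. a j * noise \<rho> n (g j) x)"
  by (induction T rule: infinite_finite_induct) (simp_all add: noise_zero noise_add noise_cmult)

lemma noise_const: "noise \<rho> n (\<lambda>x. a) x = a"
proof (induction n)
  case (Suc n)
  have "noise1 \<rho> (Suc n) (\<lambda>x. a) = (\<lambda>x. a)" by (auto simp: noise1_def field_simps)
  then show ?case using Suc by simp
qed simp

lemma noise1_mono:
  assumes "0 \<le> \<rho>" "\<rho> \<le> 1" "i \<in> {1..N}" "\<And>y. y \<in> cube N \<Longrightarrow> g y \<le> h y" "x \<in> cube N"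
  shows "noise1 \<rho> i g x \<le> noise1 \<rho> i h x"
proof -
  have "\<bar>\<rho> * x i\<bar> \<le> 1" using cube_abs[OF assms(5,3)] assms(1,2) by (simp add: abs_mult)
  then have "-1 \<le> \<rho> * x i" "\<rho> * x i \<le> 1" by linarith+
  then show ?thesis unfolding noise1_def
    using assms by (intro add_mono mult_left_mono assms(4) cube_upd) auto
qed

lemma noise_mono_le:
  assumes "0 \<le> \<rho>" "\<rho> \<le> 1" "n \<le> N" "\<And>y. y \<in> cube N \<Longrightarrow> g y \<le> h y" "x \<in> cube N"
  shows "noise \<rho> n g x \<le> noise \<rho> n h x"
  using assms(3,4)
proof (induction n arbitrary: g h)
  case (Suc n)
  have "noise1 \<rho> (Suc n) g y \<le> noise1 \<rho> (Suc n) h y" if "y \<in> cube N" for y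
    using Suc.prems assms(1,2) that by (intro noise1_mono[of _ _ N]) auto
  then show ?case using Suc by simp
qed (use assms in auto)

lemmas noise_mono = noise_mono_le[OF _ _ order_refl]

lemma noise_cong:
  assumes "\<And>y. y \<in> cube n \<Longrightarrow> g y = h y" "x \<in> cube n" "0 \<le> \<rho>" "\<rho> \<le> 1"
  shows "noise \<rho> n g x = noise \<rho> n h x"
  using assms by (intro antisym noise_mono) auto

lemma noise_nonneg:
  assumes "0 \<le> \<rho>" "\<rho> \<le> 1" "\<And>y. y \<in> cube n \<Longrightarrow> 0 \<le> h y" "x \<in> cube n"
  shows "0 \<le> noise \<rho> n h x"
  using noise_mono[of \<rho> n "\<lambda>_. 0" h x] assms by (simp add: noise_const)

lemma noise_upd:
  assumes "n < i"
  shows "noise \<rho> n h (x(i := v)) = noise \<rho> n (\<lambda>y. h (y(i := v))) x"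
  using assms
proof (induction n arbitrary: h)
  case (Suc n)
  then have eq: "(\<lambda>y. noise1 \<rho> (Suc n) h (y(i := v))) = noise1 \<rho> (Suc n) (\<lambda>y. h (y(i := v)))"
    by (simp add: noise1_def fun_upd_twist fun_eq_iff)
  have "noise \<rho> n (noise1 \<rho> (Suc n) h) (x(i := v)) =
      noise \<rho> n (\<lambda>y. noise1 \<rho> (Suc n) h (y(i := v))) x"
    by (rule Suc.IH) (use Suc.prems in simp)
  then show ?case by (simp only: noise.simps eq)
qed simp

text \<open>
  By duality: pair the vector with its own noisy value \<open>w\<close> at the point \<open>x\<close>, and use linearity,
  positivity and the Cauchy-Schwarz inequality.
\<close>

lemma noise_l2_le:
  assumes "0 \<le> \<rho>" "\<rho> \<le> 1" "finite T" "x \<in> cube n"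
  shows "sqrt (\<Sum>j\<in>T. (noise \<rho> n (g j) x)\<^sup>2) \<le> noise \<rho> n (\<lambda>y. sqrt (\<Sum>j\<in>T. (g j y)\<^sup>2)) x"
proof -
  let ?G = "\<lambda>y. sqrt (\<Sum>j\<in>T. (g j y)\<^sup>2)"
  define w where "w j = noise \<rho> n (g j) x" for j
  define A where "A = sqrt (\<Sum>j\<in>T. (w j)\<^sup>2)"
  have A: "0 \<le> A" "A\<^sup>2 = (\<Sum>j\<in>T. (w j)\<^sup>2)" by (auto simp: A_def sum_nonneg)
  have "A * A = (\<Sum>j\<in>T. w j * noise \<rho> n (g j) x)"
    using A by (simp add: power2_eq_square w_def)
  also have "\<dots> = noise \<rho> n (\<lambda>y. \<Sum>j\<in>T. w j * g j y) x" by (rule noise_sum[symmetric])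
  also have "\<dots> \<le> noise \<rho> n (\<lambda>y. A * ?G y) x"
  proof (rule noise_mono[OF assms(1,2) _ assms(4)])
    fix y
    have "(\<Sum>j\<in>T. w j * g j y) \<le> \<bar>\<Sum>j\<in>T. w j * g j y\<bar>" by simp
    also have "\<dots> \<le> L2_set w T * L2_set (\<lambda>j. g j y) T"
      by (rule order_trans[OF sum_abs]) (simp add: abs_mult L2_set_mult_ineq)
    finally show "(\<Sum>j\<in>T. w j * g j y) \<le> A * ?G y" by (simp add: A_def L2_set_def)
  qed
  also have "\<dots> = A * noise \<rho> n ?G x" by (rule noise_cmult)
  finally have *: "A * A \<le> A * noise \<rho> n ?G x" .
  have "A \<le> noise \<rho> n ?G x"
  proof (cases "A = 0")
    case True
    then show ?thesis using assms by (auto intro!: noise_nonneg sum_nonneg)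
  qed (use * A in auto)
  then show ?thesis by (simp add: A_def w_def)
qed

lemma young_powr:
  fixes c h p :: real
  assumes "0 \<le> h" "0 \<le> c" "1 \<le> p"
  shows "p * (h * c powr (p - 1)) \<le> h powr p + (p - 1) * c powr p"
proof (cases "h = 0 \<or> c = 0")
  case False
  then have pos: "0 < h" "0 < c" using assms by auto
  have "(h powr p) powr (1 / p) * (c powr p) powr ((p - 1) / p) \<le> 1 / p * h powr p + (p - 1) / p * c powr p"
    by (rule Youngs_inequality_0) (use assms pos in \<open>auto simp: field_simps\<close>)
  then have "h * c powr (p - 1) \<le> 1 / p * h powr p + (p - 1) / p * c powr p"
    using assms pos by (simp add: powr_powr)
  then have "p * (h * c powr (p - 1)) \<le> p * (1 / p * h powr p + (p - 1) / p * c powr p)"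
    using assms by (intro mult_left_mono) auto
  also have "\<dots> = h powr p + (p - 1) * c powr p" using assms by (simp add: distrib_left)
  finally show ?thesis .
qed (use assms in auto)

text \<open>
  Jensen's inequality: \<open>young_powr\<close> is the tangent-line bound for \<open>h powr p\<close> at \<open>c\<close>, and the operator
  is positive, linear and preserves constants.
\<close>

lemma noise_jensen:
  assumes \<rho>: "0 \<le> \<rho>" "\<rho> \<le> 1" and h: "\<And>y. y \<in> cube n \<Longrightarrow> 0 \<le> h y" and x: "x \<in> cube n" and p: "1 \<le> p"
  shows "noise \<rho> n h x powr p \<le> noise \<rho> n (\<lambda>y. h y powr p) x"
proof -
  define c where "c = noise \<rho> n h x"
  have c: "0 \<le> c" unfolding c_def by (intro noise_nonneg \<rho> h x)
  show ?thesis
  proof (cases "c = 0")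
    case True
    have "0 \<le> noise \<rho> n (\<lambda>y. h y powr p) x" by (intro noise_nonneg \<rho> x) auto
    then show ?thesis using True p by (simp add: c_def)
  next
    case False
    have "c powr p = p * c powr (p - 1) * c + - ((p - 1) * c powr p) * 1"
      using False c by (simp add: powr_diff algebra_simps)
    also have "\<dots> = noise \<rho> n (\<lambda>y. p * c powr (p - 1) * h y + - ((p - 1) * c powr p) * 1) x"
      by (simp only: noise_linear noise_const c_def)
    also have "\<dots> \<le> noise \<rho> n (\<lambda>y. h y powr p) x"
    proof (rule noise_mono[OF \<rho> _ x])
      fix y assume "y \<in> cube n"
      then show "p * c powr (p - 1) * h y + - ((p - 1) * c powr p) * 1 \<le> h y powr p"
        using young_powr[OF h c p, of y] by (simp add: mult_ac)
    qed
    finally show ?thesis by (simp add: c_def)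
  qed
qed

lemma noise1_walsh:
  assumes "finite S"
  shows "noise1 \<rho> i (walsh S) = (\<lambda>x. (if i \<in> S then \<rho> else 1) * walsh S x)"
proof
  fix x
  show "noise1 \<rho> i (walsh S) x = (if i \<in> S then \<rho> else 1) * walsh S x"
  proof (cases "i \<in> S")
    case True
    have upd: "walsh S (x(i := v)) = v * walsh (S - {i}) x" for v
    proof -
      have "walsh S (x(i := v)) = v * (\<Prod>j\<in>S - {i}. (x(i := v)) j)"
        using True assms by (simp add: walsh_def prod.remove)
      also have "(\<Prod>j\<in>S - {i}. (x(i := v)) j) = walsh (S - {i}) x"
        unfolding walsh_def by (rule prod.cong) auto
      finally show ?thesis .
    qed
    have "walsh S x = x i * walsh (S - {i}) x" using upd[of "x i"] by simp
    then show ?thesis using True by (simp add: noise1_def upd field_simps)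
  next
    case False
    then have "walsh S (x(i := v)) = walsh S x" for v
      unfolding walsh_def by (intro prod.cong) auto
    then show ?thesis using False by (simp add: noise1_def field_simps)
  qed
qed

lemma noise_walsh:
  assumes "finite S"
  shows "noise \<rho> n (walsh S) x = \<rho> ^ card (S \<inter> {1..n}) * walsh S x"
proof (induction n)
  case 0
  then show ?case by simp
next
  case (Suc n)
  have "S \<inter> {1..Suc n} = (if Suc n \<in> S then insert (Suc n) (S \<inter> {1..n}) else S \<inter> {1..n})"
    by (auto simp: le_Suc_eq)
  then have "card (S \<inter> {1..Suc n}) = (if Suc n \<in> S then Suc (card (S \<inter> {1..n})) else card (S \<inter> {1..n}))"
    by simp
  then show ?case using Suc by (simp add: noise1_walsh[OF assms] noise_cmult)
qed

lemma fourier_noise: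
  assumes "S \<subseteq> {1..n}" "0 \<le> \<rho>" "\<rho> \<le> 1"
  shows "fourier n (noise \<rho> n h) S = \<rho> ^ card S * fourier n h S"
proof -
  have "noise \<rho> n h x = (\<Sum>T\<in>Pow {1..n}. (\<rho> ^ card T * fourier n h T) * walsh T x)" if x: "x \<in> cube n" for x
  proof -
    have "noise \<rho> n h x = noise \<rho> n (\<lambda>x. \<Sum>T\<in>Pow {1..n}. fourier n h T * walsh T x) x"
      by (intro noise_cong walsh_inversion x assms)
    also have "\<dots> = (\<Sum>T\<in>Pow {1..n}. fourier n h T * noise \<rho> n (walsh T) x)" by (rule noise_sum)
    also have "\<dots> = (\<Sum>T\<in>Pow {1..n}. (\<rho> ^ card T * fourier n h T) * walsh T x)"
      by (rule sum.cong) (auto simp: noise_walsh finite_subset Int_absorb2)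
    finally show ?thesis .
  qed
  then show ?thesis using assms by (subst fourier_walsh_sum[where U = "Pow {1..n}"]) auto
qed

lemma cube_expectation_mono:
  assumes "\<And>x. x \<in> cube n \<Longrightarrow> g x \<le> h x"
  shows "cube_expectation n g \<le> cube_expectation n h"
  unfolding cube_expectation_eq using assms by (intro divide_right_mono sum_mono) auto

lemma cube_expectation_nonneg:
  assumes "\<And>x. x \<in> cube n \<Longrightarrow> 0 \<le> h x"
  shows "0 \<le> cube_expectation n h"
  unfolding cube_expectation_eq using assms by (intro divide_nonneg_nonneg sum_nonneg) auto

lemma cube_expectation_linear:
  "cube_expectation n (\<lambda>x. a * g x + b * h x) = a * cube_expectation n g + b * cube_expectation n h"
  by (simp add: cube_expectation_eq sum.distrib add_divide_distrib flip: sum_distrib_left)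

lemma cube_expectation_sum:
  "cube_expectation n (\<lambda>x. \<Sum>j\<in>T. g j x) = (\<Sum>j\<in>T. cube_expectation n (g j))"
  by (simp add: cube_expectation_eq sum.swap[of _ T] flip: sum_divide_distrib)

lemma cube_expectation_eq_0_iff:
  assumes "\<And>x. x \<in> cube n \<Longrightarrow> 0 \<le> h x"
  shows "cube_expectation n h = 0 \<longleftrightarrow> (\<forall>x\<in>cube n. h x = 0)"
  using assms by (simp add: cube_expectation_eq sum_nonneg_eq_0_iff)

lemma cube_expectation_noise:
  assumes "0 \<le> \<rho>" "\<rho> \<le> 1"
  shows "cube_expectation n (noise \<rho> n h) = cube_expectation n h"
  using fourier_noise[of "{}" n \<rho> h] assms by (simp add: fourier_def walsh_def)

lemma noise_noise:
  assumes "0 \<le> \<rho>" "\<rho> \<le> 1" "0 \<le> \<sigma>" "\<sigma> \<le> 1" "x \<in> cube n"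
  shows "noise \<rho> n (noise \<sigma> n h) x = noise (\<rho> * \<sigma>) n h x"
proof -
  have "\<rho> * \<sigma> \<le> 1" using assms by (simp add: mult_le_one)
  then have "fourier n (noise \<rho> n (noise \<sigma> n h)) S = fourier n (noise (\<rho> * \<sigma>) n h) S" if "S \<in> Pow {1..n}" for S
    using assms that by (simp add: fourier_noise power_mult_distrib)
  then show ?thesis
    by (subst (1 2) walsh_inversion[OF assms(5)]) (intro sum.cong, auto)
qed

section \<open>Hypercontractivity\<close>

lemma powr_plus_minus_ge:
  fixes y r :: real
  assumes y: "0 \<le> y" "y \<le> 1" and r: "0 \<le> r" "r \<le> 1"
  shows "2 * r * y \<le> (1 + y) powr r - (1 - y) powr r"
proof (cases "y = 0 \<or> r = 0")
  case False
  let ?f = "\<lambda>y. (1 + y) powr r - (1 - y) powr r - 2 * r * y"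
  have "?f 0 \<le> ?f y"
  proof (rule DERIV_nonneg_imp_increasing_open[where f = ?f])
    fix x assume x: "0 < x" "x < y"
    then have x1: "0 < 1 + x" "0 < 1 - x" using y by auto
    have D: "(?f has_real_derivative r * (1 + x) powr (r - of_nat 1) * (0 + 1) - r * (1 - x) powr (r - of_nat 1) * (0 - 1) - 2 * r * 1) (at x)"
      by (intro DERIV_diff DERIV_fun_powr DERIV_add DERIV_const DERIV_ident DERIV_cmult x1)
    have "2 \<le> (1 + x) powr (r - 1) + (1 - x) powr (r - 1)"
    proof -
      define a b where "a = (1 + x) powr ((r - 1) / 2)" and "b = (1 - x) powr ((r - 1) / 2)"
      have sq: "a\<^sup>2 = (1 + x) powr (r - 1)" "b\<^sup>2 = (1 - x) powr (r - 1)"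
        by (simp_all add: a_def b_def power2_eq_square flip: powr_add)
      have "a * b = (1 - x\<^sup>2) powr ((r - 1) / 2)"
        by (simp add: a_def b_def power2_eq_square algebra_simps flip: powr_mult)
      also have "\<dots> \<ge> 1 powr ((r - 1) / 2)"
      proof (rule powr_mono2')
        have "0 < (1 + x) * (1 - x)" using x1 by simp
        then show "0 < 1 - x\<^sup>2" by (simp add: power2_eq_square algebra_simps)
      qed (use r in auto)
      finally have "1 \<le> a * b" by simp
      moreover have "0 \<le> (a - b)\<^sup>2" by simp
      ultimately have "2 \<le> a\<^sup>2 + b\<^sup>2" by (simp add: power2_diff)
      then show ?thesis by (simp only: sq)
    qed
    then have "0 \<le> r * ((1 + x) powr (r - 1) + (1 - x) powr (r - 1) - 2)" using r by simp
    then show "\<exists>d. (?f has_real_derivative d) (at x) \<and> 0 \<le> d"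
      by (intro exI[where P = "\<lambda>d. (?f has_real_derivative d) (at x) \<and> 0 \<le> d", OF conjI[OF D]]) (simp add: algebra_simps)
  qed (use y r False in \<open>auto intro!: continuous_intros continuous_on_powr'\<close>)
  then show ?thesis by simp
qed (use y in auto)

text \<open>
  The binomial series of the right-hand side has nonnegative coefficients for exponents in
  \<open>[1, 2]\<close>, and the left-hand side consists of its first two terms. The proof compares
  derivatives instead.
\<close>

lemma powr_plus_minus_mean_ge:
  fixes y q :: real
  assumes y: "0 \<le> y" "y \<le> 1" and q: "1 \<le> q" "q \<le> 2"
  shows "1 + q * (q - 1) / 2 * y\<^sup>2 \<le> ((1 + y) powr q + (1 - y) powr q) / 2"
proof (cases "y = 0")
  case False
  let ?f = "\<lambda>y. (1 + y) powr q + (1 - y) powr q - q * (q - 1) * y\<^sup>2"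
  have "?f 0 \<le> ?f y"
  proof (rule DERIV_nonneg_imp_increasing_open[where f = ?f])
    fix x assume x: "0 < x" "x < y"
    then have x1: "0 < 1 + x" "0 < 1 - x" using y by auto
    have D: "(?f has_real_derivative q * (1 + x) powr (q - of_nat 1) * (0 + 1) + q * (1 - x) powr (q - of_nat 1) * (0 - 1) - q * (q - 1) * (2 * x)) (at x)"
      by (intro DERIV_diff DERIV_fun_powr DERIV_add DERIV_const DERIV_ident DERIV_cmult x1)
        (auto intro!: derivative_eq_intros)
    have "0 \<le> q * ((1 + x) powr (q - 1) - (1 - x) powr (q - 1) - 2 * (q - 1) * x)"
      using powr_plus_minus_ge[of x "q - 1"] x y q by simp
    then show "\<exists>d. (?f has_real_derivative d) (at x) \<and> 0 \<le> d"
      by (intro exI[where P = "\<lambda>d. (?f has_real_derivative d) (at x) \<and> 0 \<le> d", OF conjI[OF D]]) (simp add: algebra_simps)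
  qed (use y q False in \<open>auto intro!: continuous_intros continuous_on_powr'\<close>)
  then show ?thesis by (simp add: field_simps)
qed simp

text \<open>
  Bonami's two-point inequality from \<open>L\<^sup>q\<close> to \<open>L\<^sup>2\<close>. For nonnegative values only the case
  \<open>\<bar>u - v\<bar> \<le> u + v\<close> occurs. After scaling it follows from the previous lemma because
  \<open>(1 + z)\<^bsup>q/2\<^esup> \<le> 1 + (q/2) z\<close>.
\<close>

lemma two_point_inequality:
  fixes u v q :: real
  assumes uv: "0 \<le> u" "0 \<le> v" and q: "1 \<le> q" "q \<le> 2"
  shows "sqrt (((u + v) / 2)\<^sup>2 + (q - 1) * ((u - v) / 2)\<^sup>2) powr q \<le> (u powr q + v powr q) / 2"
  using uv
proof (induction u v rule: linorder_wlog)
  case (sym u v)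
  then show ?case by (simp add: add.commute power_divide power2_commute[of u v])
next
  case (le u v)
  show ?case
  proof (cases "v = 0")
    case True
    then show ?thesis using le by simp
  next
    case False
    define a where "a = (u + v) / 2"
    define y where "y = (v - u) / (u + v)"
    have a: "0 < a" using False le by (simp add: a_def)
    have y: "0 \<le> y" "y \<le> 1" using False le by (auto simp: y_def divide_le_eq)
    have uv: "u = a * (1 - y)" "v = a * (1 + y)" "(u - v) / 2 = - (a * y)"
      using False le by (auto simp: a_def y_def field_simps)
    have ay: "0 < 1 + (q - 1) * y\<^sup>2" using q by (simp add: add_pos_nonneg)
    have *: "(1 + (q - 1) * y\<^sup>2) powr (q / 2) * 1 powr (1 - q / 2) \<le> q / 2 * (1 + (q - 1) * y\<^sup>2) + (1 - q / 2) * 1"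
      using q ay by (intro Youngs_inequality_0) auto
    have 1: "(1 + (q - 1) * y\<^sup>2) powr (q / 2) \<le> ((1 + y) powr q + (1 - y) powr q) / 2"
    proof -
      have "q / 2 * (1 + (q - 1) * y\<^sup>2) + (1 - q / 2) * 1 = 1 + q * (q - 1) / 2 * y\<^sup>2"
        by (simp add: field_simps)
      then show ?thesis using powr_plus_minus_mean_ge[OF y q] * by simp
    qed
    have "a\<^sup>2 + (q - 1) * (- (a * y))\<^sup>2 = a\<^sup>2 * (1 + (q - 1) * y\<^sup>2)"
      by (simp add: power_mult_distrib algebra_simps)
    then have "sqrt (a\<^sup>2 + (q - 1) * (- (a * y))\<^sup>2) powr q = (a * sqrt (1 + (q - 1) * y\<^sup>2)) powr q"
      using a by (simp add: real_sqrt_mult)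
    also have "\<dots> = a powr q * (1 + (q - 1) * y\<^sup>2) powr (q / 2)"
      using a ay by (simp add: powr_mult powr_half_sqrt[symmetric] powr_powr)
    also have "\<dots> \<le> a powr q * (((1 + y) powr q + (1 - y) powr q) / 2)"
      using 1 by (intro mult_left_mono) auto
    also have "\<dots> = (u powr q + v powr q) / 2"
      unfolding uv(1,2) powr_mult by (simp add: field_simps)
    finally show ?thesis unfolding uv(3) a_def[symmetric] .
  qed
qed

lemma cube_extend:
  assumes "x \<in> cube n" "v \<in> {-1, 1}"
  shows "x(Suc n := v) \<in> cube (Suc n)"
  using assms by (auto simp: cube_def PiE_iff extensional_def le_Suc_eq)

lemma cube_expectation_Suc:
  "cube_expectation (Suc n) F =
     cube_expectation n (\<lambda>x. (F (x(Suc n := 1)) + F (x(Suc n := -1))) / 2)"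
proof -
  have nat: "{1..Suc n} = insert (Suc n) {1..n}" by auto
  have cube: "cube (Suc n) = (\<lambda>(v, x). x(Suc n := v)) ` ({-1, 1} \<times> cube n)"
    unfolding cube_def nat by (rule PiE_insert_eq)
  have inj: "inj_on (\<lambda>(v, x). x(Suc n := v)) ({-1, 1::real} \<times> cube n)"
    unfolding cube_def by (rule inj_combinator) simp
  have "(\<Sum>x\<in>cube (Suc n). F x) = (\<Sum>v\<in>{-1, 1}. \<Sum>x\<in>cube n. F (x(Suc n := v)))"
    unfolding cube sum.reindex[OF inj] sum.cartesian_product by (simp add: case_prod_unfold)
  then show ?thesis
    by (simp add: cube_expectation_eq sum.distrib field_simps flip: sum_divide_distrib)
qed

text \<open>
  Induction on the dimension. Averaging over the last coordinate leaves the squares of two noisy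
  functions \<open>a\<close> and \<open>\<rho> b\<close> of the other coordinates; by \<open>noise_l2_le\<close> these combine into the
  noisy version of the single nonnegative function \<open>H\<close>, and the two-point inequality bounds
  \<open>H powr q\<close> by the average of \<open>h powr q\<close>.
\<close>

theorem hypercontractivity:
  assumes \<rho>: "0 \<le> \<rho>" "\<rho> \<le> 1" and h: "\<And>x. x \<in> cube n \<Longrightarrow> 0 \<le> h x"
  shows "cube_expectation n (\<lambda>x. (noise \<rho> n h x)\<^sup>2) \<le>
    cube_expectation n (\<lambda>x. h x powr (1 + \<rho>\<^sup>2)) powr (2 / (1 + \<rho>\<^sup>2))"
  using h
proof (induction n arbitrary: h)
  case 0
  have "0 \<le> h (\<lambda>_. undefined)" by (rule 0) (simp add: cube_def)
  moreover have "(1 + \<rho>\<^sup>2) * (2 / (1 + \<rho>\<^sup>2)) = 2"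
  proof -
    have "1 + \<rho>\<^sup>2 \<noteq> 0" using add_pos_nonneg[OF zero_less_one zero_le_power2[of \<rho>]] by simp
    then show ?thesis unfolding times_divide_eq_right by (rule nonzero_mult_div_cancel_left)
  qed
  ultimately show ?case
    by (simp add: cube_expectation_eq cube_def powr_powr)
next
  case (Suc n)
  let ?q = "1 + \<rho>\<^sup>2"
  have q: "1 \<le> ?q" "?q \<le> 2" using \<rho> by (auto simp: power_le_one)
  define a where "a x = (h (x(Suc n := 1)) + h (x(Suc n := -1))) / 2" for x
  define b where "b x = (h (x(Suc n := 1)) - h (x(Suc n := -1))) / 2" for x
  define H where "H x = sqrt ((a x)\<^sup>2 + (\<rho> * b x)\<^sup>2)" for x
  have upd: "noise \<rho> (Suc n) h (x(Suc n := v)) = noise \<rho> n a x + v * (\<rho> * noise \<rho> n b x)" for x v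
  proof -
    have "(\<lambda>y. noise1 \<rho> (Suc n) h (y(Suc n := v))) = (\<lambda>y. 1 * a y + (v * \<rho>) * b y)"
      by (auto simp: noise1_def a_def b_def field_simps)
    then show ?thesis
      using noise_linear[of \<rho> n 1 a "v * \<rho>" b x] by (simp add: noise_upd mult.assoc)
  qed
  have "cube_expectation (Suc n) (\<lambda>x. (noise \<rho> (Suc n) h x)\<^sup>2) =
      cube_expectation n (\<lambda>x. (noise \<rho> n a x)\<^sup>2 + (\<rho> * noise \<rho> n b x)\<^sup>2)"
    unfolding cube_expectation_Suc upd
    by (rule arg_cong[of _ _ "cube_expectation n"]) (auto simp: power2_eq_square algebra_simps)
  also have "\<dots> \<le> cube_expectation n (\<lambda>x. (noise \<rho> n H x)\<^sup>2)"
  proof (rule cube_expectation_mono)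
    fix x assume x: "x \<in> cube n"
    let ?g = "\<lambda>i::bool. if i then a else (\<lambda>x. \<rho> * b x)"
    have "sqrt (\<Sum>i\<in>UNIV. (noise \<rho> n (?g i) x)\<^sup>2) \<le> noise \<rho> n (\<lambda>y. sqrt (\<Sum>i\<in>UNIV. (?g i y)\<^sup>2)) x"
      by (rule noise_l2_le[OF \<rho> _ x]) simp
    then have "sqrt ((noise \<rho> n a x)\<^sup>2 + (\<rho> * noise \<rho> n b x)\<^sup>2) \<le> noise \<rho> n H x"
      by (simp add: UNIV_bool H_def[abs_def] noise_cmult add.commute)
    then show "(noise \<rho> n a x)\<^sup>2 + (\<rho> * noise \<rho> n b x)\<^sup>2 \<le> (noise \<rho> n H x)\<^sup>2"
      by (rule sqrt_le_D)
  qed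
  also have "\<dots> \<le> cube_expectation n (\<lambda>x. H x powr ?q) powr (2 / ?q)"
    by (rule Suc.IH) (simp add: H_def)
  also have "\<dots> \<le> cube_expectation (Suc n) (\<lambda>x. h x powr ?q) powr (2 / ?q)"
  proof (rule powr_mono2)
    show "cube_expectation n (\<lambda>x. H x powr ?q) \<le> cube_expectation (Suc n) (\<lambda>x. h x powr ?q)"
      unfolding cube_expectation_Suc
    proof (rule cube_expectation_mono)
      fix x assume x: "x \<in> cube n"
      have "sqrt ((a x)\<^sup>2 + (?q - 1) * (b x)\<^sup>2) powr ?q \<le>
          (h (x(Suc n := 1)) powr ?q + h (x(Suc n := -1)) powr ?q) / 2"
        unfolding a_def b_def by (rule two_point_inequality) (use Suc.prems x q in \<open>auto intro: cube_extend\<close>)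
      then show "H x powr ?q \<le> (h (x(Suc n := 1)) powr ?q + h (x(Suc n := -1)) powr ?q) / 2"
        by (simp add: H_def power_mult_distrib)
    qed
  qed (auto intro!: cube_expectation_nonneg)
  finally show ?case .
qed

section \<open>Smoothed gradients\<close>

lemma derivs_insert_inner: "finite J \<Longrightarrow> i \<notin> J \<Longrightarrow> derivs (insert i J) f = derivs J (deriv1 i f)"
proof -
  assume J: "finite J" "i \<notin> J"
  interpret comp_fun_commute deriv1 by (rule comp_fun_commute_deriv1)
  show ?thesis using J by (simp add: derivs_insert) (simp add: derivs_def fold_fun_left_comm)
qed

lemma noise1_deriv1_commute:
  assumes "i \<noteq> j"
  shows "noise1 \<rho> i (deriv1 j f) = deriv1 j (noise1 \<rho> i f)"
  using assms by (auto simp: noise1_def deriv1_def fun_eq_iff fun_upd_twist field_simps)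

lemma noise1_derivs_commute:
  assumes "finite J" "i \<notin> J"
  shows "noise1 \<rho> i (derivs J f) = derivs J (noise1 \<rho> i f)"
  using assms
  by (induction J rule: finite_induct) (simp_all add: derivs_empty derivs_insert noise1_deriv1_commute)

lemma noise1_deriv1_same: "noise1 \<rho> i (deriv1 i f) = deriv1 i f"
  by (auto simp: noise1_def deriv1_def fun_eq_iff field_simps)

text \<open>
  Bessel's inequality for the biased product measure that defines the noise at \<open>x\<close>, with
  equality since all orders of derivatives are present: the noisy derivatives are, up to powers
  of \<open>sqrt (1 - \<rho>\<^sup>2)\<close>, the coefficients of \<open>f\<close> in the orthonormal basis of that measure. For one
  coordinate it is the identity \<open>(a + \<rho> b x)\<^sup>2 + (1 - \<rho>\<^sup>2) b\<^sup>2 = a\<^sup>2 + b\<^sup>2 + 2 a b \<rho> x\<close>, where \<open>x\<^sup>2 = 1\<close>.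
\<close>

lemma noise_power2:
  assumes "x \<in> cube N" "n \<le> N" "0 \<le> \<rho>" "\<rho> \<le> 1"
  shows "noise \<rho> n (\<lambda>y. (f y)\<^sup>2) x =
    (\<Sum>J\<in>Pow {1..n}. (1 - \<rho>\<^sup>2) ^ card J * (noise \<rho> n (derivs J f) x)\<^sup>2)"
  using assms(2)
proof (induction n arbitrary: f)
  case 0
  then show ?case by (simp add: derivs_empty)
next
  case (Suc n)
  let ?i = "Suc n"
  have n: "n \<le> N" using Suc.prems by simp
  have sq: "noise1 \<rho> ?i (\<lambda>y. (f y)\<^sup>2) y = (noise1 \<rho> ?i f y)\<^sup>2 + (1 - \<rho>\<^sup>2) * (deriv1 ?i f y)\<^sup>2"
    if "y \<in> cube N" for y
  proof -
    have "y ?i = 1 \<or> y ?i = -1" using cube_coord[OF that, of ?i] Suc.prems by simp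
    then show ?thesis by (auto simp: noise1_def deriv1_def power2_eq_square field_simps)
  qed
  have "noise \<rho> ?i (\<lambda>y. (f y)\<^sup>2) x =
      noise \<rho> n (\<lambda>y. 1 * (noise1 \<rho> ?i f y)\<^sup>2 + (1 - \<rho>\<^sup>2) * (deriv1 ?i f y)\<^sup>2) x"
    unfolding noise.simps
    by (intro antisym noise_mono_le[OF assms(3,4) n _ assms(1)]) (simp_all add: sq)
  also have "\<dots> = (\<Sum>J\<in>Pow {1..n}. (1 - \<rho>\<^sup>2) ^ card J * (noise \<rho> n (derivs J (noise1 \<rho> ?i f)) x)\<^sup>2)
      + (1 - \<rho>\<^sup>2) * (\<Sum>J\<in>Pow {1..n}. (1 - \<rho>\<^sup>2) ^ card J * (noise \<rho> n (derivs J (deriv1 ?i f)) x)\<^sup>2)"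
    using noise_linear[of \<rho> n 1 "\<lambda>y. (noise1 \<rho> ?i f y)\<^sup>2" "1 - \<rho>\<^sup>2" "\<lambda>y. (deriv1 ?i f y)\<^sup>2" x]
      Suc.IH[OF n, of "noise1 \<rho> ?i f"] Suc.IH[OF n, of "deriv1 ?i f"] by simp
  also have "(\<Sum>J\<in>Pow {1..n}. (1 - \<rho>\<^sup>2) ^ card J * (noise \<rho> n (derivs J (noise1 \<rho> ?i f)) x)\<^sup>2) =
      (\<Sum>J\<in>Pow {1..n}. (1 - \<rho>\<^sup>2) ^ card J * (noise \<rho> ?i (derivs J f) x)\<^sup>2)"
  proof (rule sum.cong)
    fix J assume "J \<in> Pow {1..n}"
    then have "finite J" "?i \<notin> J" by (auto simp: finite_subset)
    then show "(1 - \<rho>\<^sup>2) ^ card J * (noise \<rho> n (derivs J (noise1 \<rho> ?i f)) x)\<^sup>2 =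
        (1 - \<rho>\<^sup>2) ^ card J * (noise \<rho> ?i (derivs J f) x)\<^sup>2"
      by (simp add: noise1_derivs_commute)
  qed simp
  also have "(1 - \<rho>\<^sup>2) * (\<Sum>J\<in>Pow {1..n}. (1 - \<rho>\<^sup>2) ^ card J * (noise \<rho> n (derivs J (deriv1 ?i f)) x)\<^sup>2) =
      (\<Sum>J\<in>insert ?i ` Pow {1..n}. (1 - \<rho>\<^sup>2) ^ card J * (noise \<rho> ?i (derivs J f) x)\<^sup>2)"
  proof -
    have inj: "inj_on (insert ?i) (Pow {1..n})"
    proof (rule inj_onI)
      fix A B assume "A \<in> Pow {1..n}" "B \<in> Pow {1..n}" "insert ?i A = insert ?i B"
      moreover from this have "?i \<notin> A" "?i \<notin> B" by auto
      ultimately show "A = B" by (simp add: insert_ident)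
    qed
    have "(1 - \<rho>\<^sup>2) * ((1 - \<rho>\<^sup>2) ^ card J * (noise \<rho> n (derivs J (deriv1 ?i f)) x)\<^sup>2) =
        (1 - \<rho>\<^sup>2) ^ card (insert ?i J) * (noise \<rho> ?i (derivs (insert ?i J) f) x)\<^sup>2"
      if "J \<in> Pow {1..n}" for J
    proof -
      have J: "finite J" "?i \<notin> J" using that by (auto simp: finite_subset)
      have "noise1 \<rho> ?i (derivs (insert ?i J) f) = derivs J (deriv1 ?i f)"
        using J by (simp add: derivs_insert noise1_deriv1_same flip: derivs_insert_inner)
      then show ?thesis using J by simp
    qed
    then show ?thesis unfolding sum.reindex[OF inj] sum_distrib_left comp_def
      by (intro sum.cong refl)
  qed
  also have "(\<Sum>J\<in>Pow {1..n}. (1 - \<rho>\<^sup>2) ^ card J * (noise \<rho> ?i (derivs J f) x)\<^sup>2) +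
      (\<Sum>J\<in>insert ?i ` Pow {1..n}. (1 - \<rho>\<^sup>2) ^ card J * (noise \<rho> ?i (derivs J f) x)\<^sup>2) =
      (\<Sum>J\<in>Pow {1..?i}. (1 - \<rho>\<^sup>2) ^ card J * (noise \<rho> ?i (derivs J f) x)\<^sup>2)"
  proof -
    have "{1..?i} = insert ?i {1..n}" by auto
    then have "Pow {1..?i} = Pow {1..n} \<union> insert ?i ` Pow {1..n}" by (simp only: Pow_insert)
    moreover have "Pow {1..n} \<inter> insert ?i ` Pow {1..n} = {}" by auto
    ultimately show ?thesis by (simp add: sum.union_disjoint)
  qed
  finally show ?case .
qed

lemma fourier_derivs:
  assumes J: "J \<subseteq> {1..n}" and T: "T \<subseteq> {1..n}"
  shows "fourier n (derivs J f) T = (if T \<inter> J = {} then fourier n f (T \<union> J) else 0)"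
proof -
  let ?U = "{T. T \<subseteq> {1..n} \<and> T \<inter> J = {}}"
  have "derivs J f x = (\<Sum>T\<in>?U. fourier n f (T \<union> J) * walsh T x)" if "x \<in> cube n" for x
    unfolding derivs_fourier[OF J that]
    by (rule sum.reindex_bij_witness[of _ "\<lambda>T. T \<union> J" "\<lambda>S. S - J"])
      (use J in \<open>auto simp: Un_absorb2 Diff_triv Un_Diff\<close>)
  then have "fourier n (derivs J f) T = (if T \<in> ?U then fourier n f (T \<union> J) else 0)"
    using T by (intro fourier_walsh_sum) auto
  then show ?thesis using T by simp
qed

text \<open>
  The set \<open>S\<close> contributes once for every \<open>J \<subseteq> S\<close> of size \<open>k\<close>.
\<close>

lemma sum_fourier_derivs:
  "(\<Sum>J | J \<subseteq> {1..n} \<and> card J = k. \<Sum>T\<in>Pow {1..n}. r ^ card T * (fourier n (derivs J f) T)\<^sup>2) =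
   (\<Sum>S | S \<subseteq> {1..n} \<and> k \<le> card S. real (card S choose k) * (fourier n f S)\<^sup>2 * r ^ (card S - k))"
proof -
  let ?\<J> = "{J. J \<subseteq> {1..n} \<and> card J = k}"
  have "(\<Sum>T\<in>Pow {1..n}. r ^ card T * (fourier n (derivs J f) T)\<^sup>2) =
      (\<Sum>S\<in>Pow {1..n}. if J \<subseteq> S then (fourier n f S)\<^sup>2 * r ^ (card S - k) else 0)"
    if "J \<in> ?\<J>" for J
  proof -
    have J: "J \<subseteq> {1..n}" "card J = k" "finite J" using that by (auto simp: finite_subset)
    have "(\<Sum>T\<in>Pow {1..n}. r ^ card T * (fourier n (derivs J f) T)\<^sup>2) =
        (\<Sum>T | T \<subseteq> {1..n} \<and> T \<inter> J = {}. r ^ card T * (fourier n f (T \<union> J))\<^sup>2)"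
    proof (rule sum.mono_neutral_cong_right)
      show "\<forall>T\<in>Pow {1..n} - {T. T \<subseteq> {1..n} \<and> T \<inter> J = {}}. r ^ card T * (fourier n (derivs J f) T)\<^sup>2 = 0"
        using fourier_derivs[OF J(1)] by auto
      fix T assume "T \<in> {T. T \<subseteq> {1..n} \<and> T \<inter> J = {}}"
      then show "r ^ card T * (fourier n (derivs J f) T)\<^sup>2 = r ^ card T * (fourier n f (T \<union> J))\<^sup>2"
        using fourier_derivs[OF J(1)] by simp
    qed auto
    also have "\<dots> = (\<Sum>S | S \<subseteq> {1..n} \<and> J \<subseteq> S. (fourier n f S)\<^sup>2 * r ^ (card S - k))"
    proof (rule sum.reindex_bij_witness[of _ "\<lambda>S. S - J" "\<lambda>T. T \<union> J"])
      fix T assume T: "T \<in> {T. T \<subseteq> {1..n} \<and> T \<inter> J = {}}"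
      then have "finite T" by (auto simp: finite_subset)
      then have "card (T \<union> J) - k = card T" using T J by (simp add: card_Un_disjoint)
      then show "(fourier n f (T \<union> J))\<^sup>2 * r ^ (card (T \<union> J) - k) = r ^ card T * (fourier n f (T \<union> J))\<^sup>2"
        by simp
    qed (use J in auto)
    also have "\<dots> = (\<Sum>S\<in>Pow {1..n}. if J \<subseteq> S then (fourier n f S)\<^sup>2 * r ^ (card S - k) else 0)"
      by (rule sum.mono_neutral_cong_left) auto
    finally show ?thesis .
  qed
  then have "(\<Sum>J\<in>?\<J>. \<Sum>T\<in>Pow {1..n}. r ^ card T * (fourier n (derivs J f) T)\<^sup>2) =
      (\<Sum>J\<in>?\<J>. \<Sum>S\<in>Pow {1..n}. if J \<subseteq> S then (fourier n f S)\<^sup>2 * r ^ (card S - k) else 0)"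
    by (rule sum.cong[OF refl])
  also have "\<dots> = (\<Sum>S\<in>Pow {1..n}. \<Sum>J\<in>?\<J>. if J \<subseteq> S then (fourier n f S)\<^sup>2 * r ^ (card S - k) else 0)"
    by (rule sum.swap)
  also have "\<dots> = (\<Sum>S\<in>Pow {1..n}. real (card S choose k) * (fourier n f S)\<^sup>2 * r ^ (card S - k))"
  proof (rule sum.cong[OF refl])
    fix S assume S: "S \<in> Pow {1..n}"
    have fin: "finite ?\<J>" by simp
    have "{J \<in> ?\<J>. J \<subseteq> S} = {J. J \<subseteq> S \<and> card J = k}" using S by auto
    moreover have "finite S" using S by (auto simp: finite_subset)
    ultimately have "card {J \<in> ?\<J>. J \<subseteq> S} = card S choose k" by (simp add: n_subsets)
    then show "(\<Sum>J\<in>?\<J>. if J \<subseteq> S then (fourier n f S)\<^sup>2 * r ^ (card S - k) else 0) =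
        real (card S choose k) * (fourier n f S)\<^sup>2 * r ^ (card S - k)"
      by (simp only: sum.inter_filter[OF fin, symmetric] sum_constant mult.assoc)
  qed
  also have "\<dots> = (\<Sum>S | S \<subseteq> {1..n} \<and> k \<le> card S. real (card S choose k) * (fourier n f S)\<^sup>2 * r ^ (card S - k))"
    by (rule sum.mono_neutral_right) auto
  finally show ?thesis .
qed

definition smooth_grad :: "real \<Rightarrow> nat \<Rightarrow> nat \<Rightarrow> ((nat \<Rightarrow> real) \<Rightarrow> real) \<Rightarrow> (nat \<Rightarrow> real) \<Rightarrow> real" where
  "smooth_grad \<rho> n k f x = sqrt (\<Sum>J | J \<subseteq> {1..n} \<and> card J = k. (noise \<rho> n (derivs J f) x)\<^sup>2)"

text \<open>
  The squared \<open>L\<^sup>2\<close> norm of the smoothed gradient as a function of \<open>r = \<rho>\<^sup>2\<close>; see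
  \<open>expectation_smooth_grad_sq\<close>.
\<close>

definition grad_energy :: "nat \<Rightarrow> nat \<Rightarrow> ((nat \<Rightarrow> real) \<Rightarrow> real) \<Rightarrow> real \<Rightarrow> real" where
  "grad_energy n k f r =
     (\<Sum>S | S \<subseteq> {1..n} \<and> k \<le> card S. real (card S choose k) * (fourier n f S)\<^sup>2 * r ^ (card S - k))"

lemma smooth_grad_nonneg: "0 \<le> smooth_grad \<rho> n k f x"
  by (simp add: smooth_grad_def sum_nonneg)

lemma grad_norm_nonneg: "0 \<le> grad_norm n k f x"
  by (simp add: grad_norm_def sum_nonneg)

lemma grad_energy_nonneg: "0 \<le> r \<Longrightarrow> 0 \<le> grad_energy n k f r"
  by (simp add: grad_energy_def sum_nonneg)

lemma expectation_smooth_grad_sq: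
  assumes "0 \<le> \<rho>" "\<rho> \<le> 1"
  shows "cube_expectation n (\<lambda>x. (smooth_grad \<rho> n k f x)\<^sup>2) = grad_energy n k f (\<rho>\<^sup>2)"
proof -
  have "cube_expectation n (\<lambda>x. (smooth_grad \<rho> n k f x)\<^sup>2) =
      (\<Sum>J | J \<subseteq> {1..n} \<and> card J = k. cube_expectation n (\<lambda>x. noise \<rho> n (derivs J f) x * noise \<rho> n (derivs J f) x))"
    by (simp add: smooth_grad_def sum_nonneg cube_expectation_sum power2_eq_square)
  also have "\<dots> = (\<Sum>J | J \<subseteq> {1..n} \<and> card J = k. \<Sum>T\<in>Pow {1..n}. (\<rho>\<^sup>2) ^ card T * (fourier n (derivs J f) T)\<^sup>2)"
    unfolding parseval using assms
    by (intro sum.cong refl) (simp add: fourier_noise power2_eq_square power_mult_distrib mult_ac)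
  finally show ?thesis unfolding sum_fourier_derivs grad_energy_def .
qed

lemma expectation_grad_noise:
  assumes "0 \<le> \<rho>" "\<rho> \<le> 1"
  shows "cube_expectation n (\<lambda>x. \<Sum>J | J \<subseteq> {1..n} \<and> card J = k. derivs J f x * noise \<rho> n (derivs J f) x) =
    grad_energy n k f \<rho>"
proof -
  have "cube_expectation n (\<lambda>x. \<Sum>J | J \<subseteq> {1..n} \<and> card J = k. derivs J f x * noise \<rho> n (derivs J f) x) =
      (\<Sum>J | J \<subseteq> {1..n} \<and> card J = k. \<Sum>T\<in>Pow {1..n}. \<rho> ^ card T * (fourier n (derivs J f) T)\<^sup>2)"
    unfolding cube_expectation_sum parseval using assms
    by (intro sum.cong refl) (simp add: fourier_noise power2_eq_square mult_ac)
  then show ?thesis unfolding sum_fourier_derivs grad_energy_def .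
qed

lemma smooth_grad_le:
  assumes "0 \<le> \<rho>" "\<rho> \<le> 1" "x \<in> cube n"
  shows "smooth_grad \<rho> n k f x \<le> noise \<rho> n (grad_norm n k f) x"
  unfolding smooth_grad_def grad_norm_def[abs_def] by (rule noise_l2_le) (use assms in auto)

lemma smooth_grad_mult_le:
  assumes "0 \<le> \<rho>" "\<rho> \<le> 1" "0 \<le> \<sigma>" "\<sigma> \<le> 1" "x \<in> cube n"
  shows "smooth_grad (\<rho> * \<sigma>) n k f x \<le> noise \<rho> n (smooth_grad \<sigma> n k f) x"
proof -
  have "smooth_grad (\<rho> * \<sigma>) n k f x =
      sqrt (\<Sum>J | J \<subseteq> {1..n} \<and> card J = k. (noise \<rho> n (noise \<sigma> n (derivs J f)) x)\<^sup>2)"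
    using assms by (simp add: smooth_grad_def noise_noise)
  also have "\<dots> \<le> noise \<rho> n (smooth_grad \<sigma> n k f) x"
    unfolding smooth_grad_def[abs_def] by (rule noise_l2_le) (use assms in auto)
  finally show ?thesis .
qed

text \<open>
  Only the derivatives of order \<open>k\<close> are kept in \<open>noise_power2\<close>, whose left-hand side is at
  most 1.
\<close>

lemma smooth_grad_bounded:
  assumes "0 \<le> \<rho>" "\<rho> < 1" "x \<in> cube n" and f: "\<And>x. x \<in> cube n \<Longrightarrow> f x \<in> {-1..1}"
  shows "smooth_grad \<rho> n k f x \<le> (1 - \<rho>\<^sup>2) powr (- (real k / 2))"
proof -
  have \<rho>: "0 < 1 - \<rho>\<^sup>2" using assms by (simp add: power_less_one_iff abs_square_less_1)
  let ?\<J> = "{J. J \<subseteq> {1..n} \<and> card J = k}"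
  have "(1 - \<rho>\<^sup>2) ^ k * (smooth_grad \<rho> n k f x)\<^sup>2 =
      (\<Sum>J\<in>?\<J>. (1 - \<rho>\<^sup>2) ^ card J * (noise \<rho> n (derivs J f) x)\<^sup>2)"
    by (simp add: smooth_grad_def sum_nonneg sum_distrib_left)
  also have "\<dots> \<le> (\<Sum>J\<in>Pow {1..n}. (1 - \<rho>\<^sup>2) ^ card J * (noise \<rho> n (derivs J f) x)\<^sup>2)"
    using \<rho> by (intro sum_mono2) auto
  also have "\<dots> = noise \<rho> n (\<lambda>y. (f y)\<^sup>2) x"
    by (rule noise_power2[symmetric]) (use assms in auto)
  also have "\<dots> \<le> noise \<rho> n (\<lambda>_. 1) x"
  proof (rule noise_mono)
    fix y assume "y \<in> cube n"
    then have "\<bar>f y\<bar> \<le> 1" using f[of y] by (simp add: abs_le_iff)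
    then show "(f y)\<^sup>2 \<le> 1" by (simp add: abs_square_le_1)
  qed (use assms in auto)
  also have "\<dots> = 1" by (rule noise_const)
  finally have "(smooth_grad \<rho> n k f x)\<^sup>2 \<le> 1 / (1 - \<rho>\<^sup>2) ^ k"
    using \<rho> by (simp add: field_simps)
  also have "\<dots> = ((1 - \<rho>\<^sup>2) powr (- (real k / 2)))\<^sup>2"
    using \<rho> by (simp add: power2_eq_square powr_minus_divide powr_realpow flip: powr_add)
  finally show ?thesis by (rule power2_le_imp_le) simp
qed

lemma expectation_smooth_grad_powr_le:
  assumes "0 \<le> \<rho>" "\<rho> \<le> 1" "1 \<le> p"
  shows "cube_expectation n (\<lambda>x. smooth_grad \<rho> n k f x powr p) \<le>
    cube_expectation n (\<lambda>x. grad_norm n k f x powr p)"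
proof -
  have "cube_expectation n (\<lambda>x. smooth_grad \<rho> n k f x powr p) \<le>
      cube_expectation n (noise \<rho> n (\<lambda>x. grad_norm n k f x powr p))"
  proof (rule cube_expectation_mono)
    fix x assume x: "x \<in> cube n"
    have "smooth_grad \<rho> n k f x powr p \<le> noise \<rho> n (grad_norm n k f) x powr p"
      using assms x by (intro powr_mono2 smooth_grad_le smooth_grad_nonneg) auto
    also have "\<dots> \<le> noise \<rho> n (\<lambda>x. grad_norm n k f x powr p) x"
      by (intro noise_jensen grad_norm_nonneg assms x)
    finally show "smooth_grad \<rho> n k f x powr p \<le> noise \<rho> n (\<lambda>x. grad_norm n k f x powr p) x" .
  qed
  then show ?thesis using assms by (simp add: cube_expectation_noise)
qed

text \<open>
  Writing the energy as an inner product leaves the gradient itself in one factor, so that all the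
  smoothing is available for the pointwise bound on the other: \<open>\<rho>\<close> appears here, not \<open>sqrt \<rho>\<close>.
  Of the product \<open>\<bar>g\<bar> \<bar>P\<^sub>\<rho> g\<bar>\<close>, the power \<open>2-p\<close> of the second factor is bounded
  pointwise; Young's inequality and the contraction property handle the rest.
\<close>

lemma grad_energy_le:
  assumes \<rho>: "0 \<le> \<rho>" "\<rho> < 1" and p: "1 \<le> p" "p \<le> 2" and f: "\<And>x. x \<in> cube n \<Longrightarrow> f x \<in> {-1..1}"
  shows "grad_energy n k f \<rho> \<le>
    cube_expectation n (\<lambda>x. grad_norm n k f x powr p) * (1 - \<rho>\<^sup>2) powr (- (real k * (1 - p / 2)))"
proof -
  let ?G = "grad_norm n k f" and ?H = "smooth_grad \<rho> n k f"
  define B where "B = (1 - \<rho>\<^sup>2) powr (- (real k * (1 - p / 2)))"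
  have "grad_energy n k f \<rho> \<le> cube_expectation n (\<lambda>x. B / p * ?G x powr p + B * (p - 1) / p * ?H x powr p)"
    unfolding expectation_grad_noise[OF \<rho>(1) less_imp_le[OF \<rho>(2)], symmetric]
  proof (rule cube_expectation_mono)
    fix x assume x: "x \<in> cube n"
    have "(\<Sum>J | J \<subseteq> {1..n} \<and> card J = k. derivs J f x * noise \<rho> n (derivs J f) x) \<le> ?G x * ?H x"
      unfolding grad_norm_def smooth_grad_def L2_set_def[symmetric]
      by (rule order_trans[OF abs_ge_self order_trans[OF sum_abs]]) (simp add: abs_mult L2_set_mult_ineq)
    also have "\<dots> \<le> ?G x * ?H x powr (p - 1) * B"
    proof (cases "?H x = 0")
      case False
      then have H: "0 < ?H x" using smooth_grad_nonneg[of \<rho> n k f x] by simp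
      have "?H x = ?H x powr (p - 1) * ?H x powr (2 - p)"
        using H by (simp flip: powr_add)
      also have "\<dots> \<le> ?H x powr (p - 1) * ((1 - \<rho>\<^sup>2) powr (- (real k / 2))) powr (2 - p)"
        using p H x \<rho> f by (intro mult_left_mono powr_mono2 smooth_grad_bounded) auto
      also have "\<dots> = ?H x powr (p - 1) * B"
        by (simp add: B_def powr_powr field_simps)
      finally show ?thesis
        using mult_left_mono[OF _ grad_norm_nonneg[of n k f x]] by (simp only: mult.assoc)
    qed simp
    also have "\<dots> = B / p * (p * (?G x * ?H x powr (p - 1)))" using p by simp
    also have "\<dots> \<le> B / p * (?G x powr p + (p - 1) * ?H x powr p)"
      using p by (intro mult_left_mono young_powr grad_norm_nonneg smooth_grad_nonneg) (auto simp: B_def)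
    also have "\<dots> = B / p * ?G x powr p + B * (p - 1) / p * ?H x powr p"
      by (simp add: distrib_left)
    finally show "(\<Sum>J | J \<subseteq> {1..n} \<and> card J = k. derivs J f x * noise \<rho> n (derivs J f) x) \<le>
        B / p * ?G x powr p + B * (p - 1) / p * ?H x powr p" .
  qed
  also have "\<dots> = B / p * cube_expectation n (\<lambda>x. ?G x powr p) + B * (p - 1) / p * cube_expectation n (\<lambda>x. ?H x powr p)"
    by (rule cube_expectation_linear)
  also have "\<dots> \<le> B / p * cube_expectation n (\<lambda>x. ?G x powr p) + B * (p - 1) / p * cube_expectation n (\<lambda>x. ?G x powr p)"
    using p \<rho> by (intro add_left_mono mult_left_mono expectation_smooth_grad_powr_le) (auto simp: B_def)
  also have "\<dots> = cube_expectation n (\<lambda>x. ?G x powr p) * B"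
    using p by (simp add: field_simps)
  finally show ?thesis by (simp only: B_def)
qed

text \<open>
  Log-convexity of the moments in the exponent. Young's inequality is applied at every point to
  the normalised powers.
\<close>

lemma expectation_powr_interpolate:
  assumes h: "\<And>x. x \<in> cube n \<Longrightarrow> 0 \<le> h x" and l: "0 \<le> l" "l \<le> 1" and ab: "0 < a" "0 < b"
  shows "cube_expectation n (\<lambda>x. h x powr (l * a + (1 - l) * b)) \<le>
    cube_expectation n (\<lambda>x. h x powr a) powr l * cube_expectation n (\<lambda>x. h x powr b) powr (1 - l)"
proof -
  define A where "A = cube_expectation n (\<lambda>x. h x powr a)"
  define B where "B = cube_expectation n (\<lambda>x. h x powr b)"
  have nn: "0 \<le> A" "0 \<le> B" unfolding A_def B_def by (intro cube_expectation_nonneg; simp)+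
  show ?thesis
  proof (cases "\<forall>x\<in>cube n. h x = 0")
    case True
    then have "cube_expectation n (\<lambda>x. h x powr (l * a + (1 - l) * b)) = 0" by (simp add: cube_expectation_eq)
    then show ?thesis by (simp add: mult_nonneg_nonneg)
  next
    case False
    then have "A \<noteq> 0" "B \<noteq> 0" unfolding A_def B_def by (simp_all add: cube_expectation_eq_0_iff)
    then have pos: "0 < A" "0 < B" using nn by auto
    define K where "K = A powr l * B powr (1 - l)"
    have K: "0 \<le> K" by (simp add: K_def)
    have "cube_expectation n (\<lambda>x. h x powr (l * a + (1 - l) * b)) \<le>
        cube_expectation n (\<lambda>x. K * l / A * h x powr a + K * (1 - l) / B * h x powr b)"
    proof (rule cube_expectation_mono)
      fix x assume "x \<in> cube n"
      then have "0 \<le> h x" by (rule h)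
      show "h x powr (l * a + (1 - l) * b) \<le> K * l / A * h x powr a + K * (1 - l) / B * h x powr b"
      proof (cases "h x = 0")
        case False
        with \<open>0 \<le> h x\<close> have hx: "0 < h x" by simp
        have "(h x powr a / A) powr l * (h x powr b / B) powr (1 - l) \<le> l * (h x powr a / A) + (1 - l) * (h x powr b / B)"
          using l pos hx by (intro Youngs_inequality_0) auto
        then have "K * ((h x powr a / A) powr l * (h x powr b / B) powr (1 - l)) \<le> K * (l * (h x powr a / A) + (1 - l) * (h x powr b / B))"
          using K by (rule mult_left_mono)
        moreover have "K * ((h x powr a / A) powr l * (h x powr b / B) powr (1 - l)) = h x powr (l * a + (1 - l) * b)"
          using pos by (simp add: K_def powr_divide powr_powr powr_add mult_ac)
        ultimately show ?thesis by (simp add: algebra_simps)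
      qed (use K l pos in simp)
    qed
    also have "\<dots> = K * l / A * A + K * (1 - l) / B * B"
      unfolding cube_expectation_linear A_def B_def ..
    also have "\<dots> = K * l + K * (1 - l)" using pos by simp
    also have "\<dots> = K" by (simp add: algebra_simps)
    finally show ?thesis by (simp only: K_def A_def B_def)
  qed
qed

text \<open>
  The extra noise \<open>sqrt v\<close> maps \<open>L\<close> with exponent \<open>1 + v\<close> into \<open>L\<^sup>2\<close>, and the norm with exponent
  \<open>1 + v\<close> is interpolated between \<open>L\<^sup>q\<close> and \<open>L\<^sup>2\<close>. The condition \<open>\<theta> \<le> 1\<close> says that \<open>q \<le> 1 + v\<close>.
\<close>

lemma grad_energy_decay:
  assumes u: "0 \<le> u" "u \<le> 1" and v: "0 < v" "v \<le> 1" and q: "1 \<le> q" "q < 2"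
    and \<theta>: "\<theta> = q / (2 - q) * ((1 - v) / (1 + v))" "\<theta> \<le> 1"
  shows "grad_energy n k f (v * u) \<le>
    grad_energy n k f u powr (1 - \<theta>) * (cube_expectation n (\<lambda>x. grad_norm n k f x powr q) powr (2 / q)) powr \<theta>"
proof -
  let ?h = "smooth_grad (sqrt u) n k f"
  define l where "l = (1 + v - q) / (2 - q)"
  have th: "1 - \<theta> = l * (2 / (1 + v))" "2 / q * \<theta> = (1 - l) * (2 / (1 + v))"
    using q v by (simp_all add: \<theta> l_def divide_simps) (simp_all add: algebra_simps)
  have "0 \<le> l * (2 / (1 + v))" using th(1) \<theta>(2) by simp
  then have l: "0 \<le> l" using v by (simp add: zero_le_mult_iff zero_le_divide_iff)
  have l1: "l \<le> 1" using q v by (simp add: l_def divide_le_eq)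
  have s: "1 + v = l * 2 + (1 - l) * q"
  proof -
    have "l * (2 - q) = 1 + v - q" using q by (simp add: l_def)
    then show ?thesis by (simp add: algebra_simps)
  qed
  have sq: "0 \<le> sqrt u" "sqrt u \<le> 1" "0 \<le> sqrt v" "sqrt v \<le> 1" using u v by auto
  have "grad_energy n k f (v * u) = cube_expectation n (\<lambda>x. (smooth_grad (sqrt v * sqrt u) n k f x)\<^sup>2)"
    using u v sq by (subst expectation_smooth_grad_sq) (auto simp: power_mult_distrib mult_le_one)
  also have "\<dots> \<le> cube_expectation n (\<lambda>x. (noise (sqrt v) n ?h x)\<^sup>2)"
    using sq by (intro cube_expectation_mono power_mono smooth_grad_mult_le smooth_grad_nonneg)
  also have "\<dots> \<le> cube_expectation n (\<lambda>x. ?h x powr (1 + (sqrt v)\<^sup>2)) powr (2 / (1 + (sqrt v)\<^sup>2))"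
    by (rule hypercontractivity) (use sq smooth_grad_nonneg in auto)
  also have "\<dots> = cube_expectation n (\<lambda>x. ?h x powr (l * 2 + (1 - l) * q)) powr (2 / (1 + v))"
    using v s by simp
  also have "\<dots> \<le> (cube_expectation n (\<lambda>x. ?h x powr 2) powr l * cube_expectation n (\<lambda>x. ?h x powr q) powr (1 - l)) powr (2 / (1 + v))"
    using v q l l1 smooth_grad_nonneg
    by (intro powr_mono2 expectation_powr_interpolate cube_expectation_nonneg) auto
  also have "\<dots> = cube_expectation n (\<lambda>x. ?h x powr 2) powr (1 - \<theta>) * cube_expectation n (\<lambda>x. ?h x powr q) powr (2 / q * \<theta>)"
    unfolding th by (simp add: powr_mult powr_powr)
  also have "cube_expectation n (\<lambda>x. ?h x powr 2) = grad_energy n k f u"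
    using expectation_smooth_grad_sq[OF sq(1,2), of n k f] u smooth_grad_nonneg
    by (simp add: powr_numeral)
  also have "cube_expectation n (\<lambda>x. ?h x powr q) powr (2 / q * \<theta>) \<le>
      cube_expectation n (\<lambda>x. grad_norm n k f x powr q) powr (2 / q * \<theta>)"
  proof (intro powr_mono2 expectation_smooth_grad_powr_le sq cube_expectation_nonneg)
    show "0 \<le> 2 / q * \<theta>" using q v by (simp add: \<theta>)
  qed (use q in auto)
  finally show ?thesis by (simp add: powr_powr mult_left_mono)
qed

text \<open>
  The normalisation that makes the \<open>k\<close>-fold average of the energy at time 0 equal to the weight.
\<close>

lemma choose_mult_prod:
  "real (d + k choose k) * (\<Prod>l=1..k. real l / (real d + real l)) = 1"
proof (induction k)
  case (Suc k)
  have "Suc k * (Suc (d + k) choose Suc k) = Suc (d + k) * (d + k choose k)"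
    by (rule Suc_times_binomial)
  then have "real (Suc k) * real (d + Suc k choose Suc k) = real (Suc (d + k)) * real (d + k choose k)"
    by (metis add_Suc_right of_nat_mult)
  then have step: "real (d + Suc k choose Suc k) * (real (Suc k) / (real d + real (Suc k))) = real (d + k choose k)"
    by (simp add: field_simps)
  have eq: "real (d + Suc k choose Suc k) * (\<Prod>l=1..Suc k. real l / (real d + real l)) =
      (real (d + Suc k choose Suc k) * (real (Suc k) / (real d + real (Suc k)))) *
      (\<Prod>l=1..k. real l / (real d + real l))"
    by (simp only: prod.nat_ivl_Suc' le_add1 One_nat_def Suc_le_mono le0 mult_ac)
  show ?case unfolding eq step by (rule Suc.IH)
qed simp

section \<open>The inequality with the weight inside the logarithm\<close>

text \<open>
  Specialises \<open>weight_le\<close> to the energy \<open>Q(s) = grad_energy n k f (exp (- s))\<close>. If the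
  weight is below \<open>N\<close>, the logarithm is replaced by 0 and monotonicity of \<open>Q\<close> suffices,
  which is the case \<open>\<alpha> = 0\<close> of the decay assumption.
\<close>

theorem high_weight_le:
  fixes p q :: real
  assumes f: "\<And>x. x \<in> cube n \<Longrightarrow> f x \<in> {-1..1}" and k: "1 \<le> k"
    and q: "1 \<le> q" "q < 2" and p: "1 \<le> p" "p \<le> 2"
    and x: "0 < x" "x < 2" "x \<le> 2 * (2 - q) / q"
    and pos: "0 < high_weight n k f"
    and N: "N = cube_expectation n (\<lambda>x. grad_norm n k f x powr q) powr (2 / q)" "0 < N"
  shows "(1 - exp (- x)) ^ k * high_weight n k f \<le>
    cube_expectation n (\<lambda>x. grad_norm n k f x powr p) *
      (2 powr (p / 2) / p * (x / (1 + q / (2 * real k * (2 - q)) * ln_plus (high_weight n k f / N))) powr (p / 2)) ^ k"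
proof -
  let ?I = "{S. S \<subseteq> {1..n} \<and> k \<le> card S}"
  let ?W = "high_weight n k f"
  define c where "c S = real (card S choose k) * (fourier n f S)\<^sup>2" for S
  define d where "d S = card S - k" for S :: "nat set"
  have Q: "exp_sum ?I c d 0 s = grad_energy n k f (exp (- s))" for s
    by (simp add: exp_sum_def grad_energy_def c_def d_def flip: exp_of_nat_mult)
  have Wk: "?W = exp_sum ?I c d k 0"
    unfolding high_weight_fourier exp_sum_def
  proof (rule sum.cong[OF refl])
    fix S assume "S \<in> ?I"
    then have "card S = d S + k" by (simp add: d_def)
    then have "real (card S choose k) * (\<Prod>l=1..k. real l / (real (d S) + real l)) = 1"
      using choose_mult_prod by simp
    then show "(fourier n f S)\<^sup>2 = c S * (\<Prod>l=1..k. real l / (real (d S) + real l)) * exp (- (real (d S) * 0))"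
      by (simp add: c_def mult_ac)
  qed
  have Wnn: "0 \<le> ?W" using pos by simp
  define \<alpha> where "\<alpha> = (if N \<le> ?W then q / (2 - q) / 2 else 0)"
  define L where "L = ln_plus (?W / N)"
  have \<alpha>: "0 \<le> \<alpha>" using q by (simp add: \<alpha>_def)
  have L: "0 \<le> L" by (simp add: L_def ln_plus_def)
  interpret decay ?I c d \<alpha> L ?W
  proof
    fix s r :: real assume s: "0 \<le> s" and r: "0 \<le> r" and le: "\<alpha> * tau r \<le> 1"
    have u: "0 < exp (- s)" "exp (- s) \<le> 1" and v: "0 < exp (- r)" "exp (- r) \<le> 1" using s r by auto
    have mult: "exp (- (s + r)) = exp (- r) * exp (- s)" by (simp flip: exp_add)
    have Enn: "0 \<le> grad_energy n k f (exp (- s))" by (simp add: grad_energy_nonneg)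
    show "exp_sum ?I c d 0 (s + r) \<le> exp (- (\<alpha> * tau r * L)) *
        ((1 - \<alpha> * tau r) * exp_sum ?I c d 0 s + \<alpha> * tau r * ?W)"
    proof (cases "N \<le> ?W")
      case False
      have "grad_energy n k f (exp (- (s + r))) \<le> grad_energy n k f (exp (- s))"
        unfolding grad_energy_def mult using u v
        by (intro sum_mono mult_left_mono power_mono) (auto simp: mult_le_cancel_right2)
      then show ?thesis unfolding Q using False by (simp add: \<alpha>_def)
    next
      case True
      define \<theta> where "\<theta> = \<alpha> * tau r"
      define E where "E = grad_energy n k f (exp (- s))"
      have Lln: "L = ln (?W / N)" using True N by (simp add: L_def ln_plus_def)
      have th: "\<theta> = q / (2 - q) * ((1 - exp (- r)) / (1 + exp (- r)))"
      proof -
        have "\<alpha> * tau r = q / (2 - q) / 2 * (2 * ((1 - exp (- r)) / (1 + exp (- r))))"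
          using True by (simp only: \<alpha>_def tau_eq if_True times_divide_eq_right)
        also have "\<dots> = q / (2 - q) * ((1 - exp (- r)) / (1 + exp (- r)))"
          by (metis (no_types) mult.assoc nonzero_eq_divide_eq zero_neq_numeral)
        finally show ?thesis by (simp only: \<theta>_def)
      qed
      have th0: "0 \<le> \<theta>" using \<alpha> tau_nonneg[OF r] by (simp add: \<theta>_def)
      have "grad_energy n k f (exp (- r) * exp (- s)) \<le> E powr (1 - \<theta>) * N powr \<theta>"
        unfolding N(1) E_def by (rule grad_energy_decay) (use u v q th le \<theta>_def in auto)
      also have "\<dots> = exp (- (\<theta> * L)) * (E powr (1 - \<theta>) * ?W powr \<theta>)"
        using pos N by (simp add: Lln powr_def ln_div exp_diff algebra_simps flip: exp_add)
      also have "\<dots> \<le> exp (- (\<theta> * L)) * ((1 - \<theta>) * E + \<theta> * ?W)"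
      proof (rule mult_left_mono)
        show "E powr (1 - \<theta>) * ?W powr \<theta> \<le> (1 - \<theta>) * E + \<theta> * ?W"
        proof (cases "E = 0")
          case True
          then show ?thesis using th0 pos by simp
        next
          case False
          then show ?thesis using th0 le pos Enn by (intro Youngs_inequality_0) (auto simp: \<theta>_def E_def)
        qed
      qed simp
      finally show ?thesis by (simp only: Q mult E_def \<theta>_def)
    qed
  qed (use \<alpha> L Wnn in auto)
  let ?\<delta> = "1 - p / 2"
  have bound: "exp_sum ?I c d 0 s \<le> cube_expectation n (\<lambda>x. grad_norm n k f x powr p) *
      (1 - exp (- 2 * s)) powr (- (real k * ?\<delta>))" if "0 < s" for s
    unfolding Q using grad_energy_le[of "exp (- s)" p n f k] f p that
    by (simp add: power2_eq_square flip: exp_add)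
  have le: "(1 - exp (- x)) ^ k * ?W \<le> cube_expectation n (\<lambda>x. grad_norm n k f x powr p) *
    (2 powr (- ?\<delta>) / (1 - ?\<delta>) * (x / (1 + \<alpha> * L / real k)) powr (1 - ?\<delta>)) ^ k"
  proof (rule weight_le[OF k x(1,2) _ _ _ _ bound Wk])
    show "\<alpha> * x \<le> 1" using x q by (simp add: \<alpha>_def field_simps)
    show "0 \<le> cube_expectation n (\<lambda>x. grad_norm n k f x powr p)" by (intro cube_expectation_nonneg) simp
  qed (use p in auto)
  have rate: "\<alpha> * L / real k = q / (2 * real k * (2 - q)) * ln_plus (?W / N)"
  proof (cases "N \<le> ?W")
    case True
    then show ?thesis by (simp add: \<alpha>_def L_def)
  next
    case False
    then have "?W / N \<le> 1" using N(2) by simp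
    then have "ln (?W / N) \<le> 0" using pos N(2) by simp
    then have "ln_plus (?W / N) = 0" by (simp add: ln_plus_def)
    then show ?thesis using False by (simp add: \<alpha>_def)
  qed
  have const: "2 powr (- ?\<delta>) / (1 - ?\<delta>) = 2 powr (p / 2) / p"
  proof -
    have "- ?\<delta> = p / 2 - 1" "1 - ?\<delta> = p / 2" by simp_all
    then show ?thesis by (simp only: powr_diff) simp
  qed
  show ?thesis using le unfolding rate const by simp
qed

section \<open>The constants\<close>

lemma exp_greater_quadratic:
  fixes x :: real
  assumes "0 < x"
  shows "1 + x + x\<^sup>2 / 2 < exp x"
proof -
  have "1 + x + x\<^sup>2 / 2 < (1 + x / 2 + (x / 2)\<^sup>2 / 2)\<^sup>2"
  proof -
    have "(1 + x / 2 + (x / 2)\<^sup>2 / 2)\<^sup>2 = 1 + x + x\<^sup>2 / 2 + (x ^ 3 / 8 + x ^ 4 / 64)"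
      by (simp add: power2_eq_square power3_eq_cube power4_eq_xxxx field_simps)
    moreover have "0 < x ^ 3 / 8 + x ^ 4 / 64" using assms by (intro add_pos_pos) auto
    ultimately show ?thesis by linarith
  qed
  also have "\<dots> \<le> (exp (x / 2))\<^sup>2"
    using assms by (intro power_mono exp_lower_Taylor_quadratic) auto
  also have "\<dots> = exp x" by (simp add: power2_eq_square flip: exp_add)
  finally show ?thesis .
qed

text \<open>
  At a positive maximiser the derivative vanishes, so \<open>x = (p/2)(exp x - 1) > (p/2)(x + x\<^sup>2/2)\<close>.
\<close>

lemma M_fun_maximizer_less:
  assumes p: "1 \<le> p" "p \<le> 2" and x: "0 < x" and max: "\<And>y. 0 \<le> y \<Longrightarrow> M_fun p y \<le> M_fun p x"
  shows "x < 2 * (2 - p) / p"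
proof -
  let ?g = "\<lambda>y. (1 - exp (- y)) * y powr (- (p / 2))"
  have g: "M_fun p y = ?g y" if "0 < y" for y
    using that by (simp add: M_fun_def powr_minus_divide)
  have D: "(?g has_real_derivative
      (exp (- x) * x powr (- (p / 2)) + - (p / 2) * x powr (- (p / 2) - of_nat 1) * 1 * (1 - exp (- x)))) (at x)"
  proof (rule DERIV_mult)
    show "((\<lambda>y. 1 - exp (- y)) has_real_derivative exp (- x)) (at x)"
      by (auto intro!: derivative_eq_intros)
  qed (rule DERIV_fun_powr[OF DERIV_ident x])
  have "exp (- x) * x powr (- (p / 2)) + - (p / 2) * x powr (- (p / 2) - of_nat 1) * 1 * (1 - exp (- x)) = 0"
  proof (rule DERIV_local_max[OF D x])
    show "\<forall>y. \<bar>x - y\<bar> < x \<longrightarrow> ?g y \<le> ?g x"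
    proof (intro allI impI)
      fix y assume "\<bar>x - y\<bar> < x"
      then have "0 < y" by linarith
      then show "?g y \<le> ?g x" using max[of y] x by (simp add: g)
    qed
  qed
  moreover have "x powr (- (p / 2)) = x * x powr (- (p / 2) - of_nat 1)"
    using x by (simp add: powr_diff)
  ultimately have "(exp (- x) * x - p / 2 * (1 - exp (- x))) * x powr (- (p / 2) - of_nat 1) = 0"
    by (simp only:) (simp add: algebra_simps)
  then have "exp (- x) * x = p / 2 * (1 - exp (- x))" using x by simp
  then have "exp x * (exp (- x) * x) = exp x * (p / 2 * (1 - exp (- x)))" by simp
  then have "x = p / 2 * (exp x - 1)"
    by (simp add: algebra_simps exp_minus_inverse)
  also have "\<dots> > p / 2 * (x + x\<^sup>2 / 2)"
    using exp_greater_quadratic[OF x] p by (intro mult_strict_left_mono) auto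
  finally have "p / 2 * (1 + x / 2) * x < 1 * x" by (simp add: power2_eq_square algebra_simps)
  then have "p / 2 * (1 + x / 2) < 1" using x by (simp only: mult_less_cancel_right_pos)
  then show ?thesis using p by (simp add: field_simps)
qed

text \<open>
  The range \<open>x \<le> 2(2-q)/q\<close> in which hypercontractivity can be used contains the maximiser, because
  \<open>q \<le> p\<close>; the maximiser is also below 2, because \<open>p \<ge> 1\<close>. If the maximiser is 0, the
  value of \<open>M_fun\<close> there is a limit from the right.
\<close>

lemma SUP_M_fun_le:
  assumes p: "1 \<le> p" "p \<le> 2" and q: "1 \<le> q" "q \<le> p" "q < 2"
    and B: "\<And>x. 0 < x \<Longrightarrow> x < 2 \<Longrightarrow> x \<le> 2 * (2 - q) / q \<Longrightarrow> M_fun p x \<le> B"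
  shows "(SUP x\<in>{0..}. M_fun p x) \<le> B"
proof -
  obtain x where x: "0 \<le> x" and max: "\<And>y. 0 \<le> y \<Longrightarrow> M_fun p y \<le> M_fun p x"
    using M_fun_attains_max[OF p] by blast
  have "M_fun p x \<le> B"
  proof (cases "x = 0")
    case False
    then have x0: "0 < x" using x by simp
    have xp: "x < 2 * (2 - p) / p" by (rule M_fun_maximizer_less[OF p x0 max])
    have "2 * (2 - p) / p = 4 / p - 2" "2 * (2 - q) / q = 4 / q - 2"
      using p q by (simp_all add: field_simps)
    moreover have "4 / p \<le> 4 / q" "4 / q \<le> 4 / 1" using p q by (intro divide_left_mono; simp)+
    ultimately show ?thesis using xp x0 by (intro B) auto
  next
    case True
    have lim: "((\<lambda>y. (1 - exp (- y)) / y powr (p / 2)) \<longlongrightarrow> M_fun p 0) (at_right (0::real))"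
      using M_fun_0[OF p] by simp
    have "0 < min 2 (2 * (2 - q) / q)" using q by simp
    then have "\<forall>\<^sub>F y in at_right 0. y \<in> {0<..<min 2 (2 * (2 - q) / q)}"
      by (rule eventually_at_right_real)
    then have "\<forall>\<^sub>F y in at_right 0. (1 - exp (- y)) / y powr (p / 2) \<le> B"
    proof eventually_elim
      case (elim y)
      then show ?case using B[of y] by (simp add: M_fun_def)
    qed
    then show ?thesis using tendsto_upperbound[OF lim] True by simp
  qed
  then show ?thesis using max by (intro cSUP_least) (auto intro: order_trans)
qed

lemma M_const_ge:
  assumes p: "1 \<le> p" "p \<le> 2"
  shows "1 / 4 \<le> M_const p"
proof -
  obtain x where max: "\<And>y. 0 \<le> y \<Longrightarrow> M_fun p y \<le> M_fun p x"
    using M_fun_attains_max[OF p] by blast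
  have "M_fun p 1 \<le> (SUP x\<in>{0..}. M_fun p x)"
    by (rule cSUP_upper) (auto intro!: bdd_aboveI2[of _ _ "M_fun p x"] max)
  moreover have "1 / 2 \<le> M_fun p 1"
  proof -
    have "2 \<le> exp (1::real)" using exp_ge_add_one_self[of 1] by simp
    then have "exp (- (1::real)) \<le> 1 / 2" by (simp add: exp_minus field_simps)
    then show ?thesis by (simp add: M_fun_def)
  qed
  ultimately have "1 / 2 \<le> (SUP x\<in>{0..}. M_fun p x)" by linarith
  moreover have "1 * (1 / 2) \<le> p * 2 powr (- p / 2)"
  proof (rule mult_mono)
    have "2 powr (-1) \<le> (2::real) powr (- p / 2)" using p by (intro powr_mono) auto
    then show "1 / 2 \<le> (2::real) powr (- p / 2)" by (simp add: powr_minus_divide)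
  qed (use p in auto)
  ultimately have "1 * (1 / 2) * (1 / 2) \<le> p * 2 powr (- p / 2) * (SUP x\<in>{0..}. M_fun p x)"
    using p by (intro mult_mono[of "1 * (1 / 2)"]) auto
  then show ?thesis by (simp add: M_const_def)
qed

text \<open>
  From \<open>M_const p \<ge> 1/4\<close> the bracket in \<open>C_const\<close> is at most \<open>16 + 1/(2-q) \<le> 17/(2-q)\<close>, and its
  exponent is at least \<open>-1\<close>.
\<close>

lemma C_const_ge:
  assumes "1 \<le> q" "q \<le> p" "p \<le> 2" "q < 2"
  shows "1 / 17 * (2 - q) \<le> C_const p q"
proof -
  have p: "1 \<le> p" using assms by simp
  have M: "1 / 4 \<le> M_const p" by (rule M_const_ge) (use assms p in auto)
  define A where "A = M_const p powr (- 2 / p) + p * q / (4 * exp 1 * (2 - q))"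
  have "M_const p powr (- 2 / p) \<le> (1 / 4) powr (- 2 / p)"
    using M assms p by (intro powr_mono2') auto
  also have "\<dots> = 4 powr (2 / p)" by (simp add: powr_divide powr_minus_divide)
  also have "\<dots> \<le> 4 powr 2" using p by (intro powr_mono) (auto simp: field_simps)
  finally have M16: "M_const p powr (- 2 / p) \<le> 16" by simp
  have "p * q / (4 * exp 1 * (2 - q)) \<le> 2 * 2 / (4 * 1 * (2 - q))"
    using assms p by (intro frac_le mult_mono mult_right_mono) auto
  also have "\<dots> = 1 / (2 - q)" using assms by (simp add: divide_simps)
  finally have "A \<le> 16 + 1 / (2 - q)" using M16 by (simp add: A_def)
  also have "\<dots> \<le> 17 / (2 - q)"
  proof -
    have "1 \<le> 1 / (2 - q)" using assms by simp
    then have "16 + 1 / (2 - q) \<le> 17 * (1 / (2 - q))" by linarith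
    then show ?thesis by simp
  qed
  finally have A17: "A \<le> 17 / (2 - q)" .
  have A0: "0 < A" unfolding A_def using M assms p by (intro add_pos_nonneg) auto
  have "1 / 17 * (2 - q) = ((2 - q) / 17) powr 1" using assms by simp
  also have "\<dots> \<le> ((2 - q) / 17) powr (p / 2)" using assms by (intro powr_mono') auto
  also have "\<dots> = (17 / (2 - q)) powr (- p / 2)"
    using assms by (simp add: powr_divide powr_minus field_simps)
  also have "\<dots> \<le> A powr (- p / 2)" using A0 A17 p by (intro powr_mono2') auto
  finally show ?thesis by (simp add: C_const_def A_def)
qed

lemma mult_ln_plus_inverse_le:
  fixes y :: real
  assumes "0 < y"
  shows "y * ln_plus (1 / y) \<le> 1 / exp 1"
proof -
  have "ln (1 / y / exp 1) \<le> 1 / y / exp 1 - 1"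
    using assms by (intro ln_le_minus_one) auto
  moreover have "ln (1 / y / exp 1) = ln (1 / y) - 1" using assms by (subst ln_div) auto
  ultimately have "ln (1 / y) \<le> 1 / y / exp 1" by simp
  then have "ln_plus (1 / y) \<le> 1 / y / exp 1" using assms by (simp add: ln_plus_def)
  then have "y * ln_plus (1 / y) \<le> y * (1 / y / exp 1)" using assms by (intro mult_left_mono) auto
  then show ?thesis using assms by simp
qed

lemma ln_plus_mult_le:
  assumes "0 < x" "0 < y"
  shows "ln_plus (x * y) \<le> ln_plus x + ln_plus y"
  using assms by (simp add: ln_plus_def ln_mult)

text \<open>
  Put \<open>m = kp/2\<close> and \<open>y = (W/P)\<^bsup>1/m\<^esup>\<close>. The hypothesis says \<open>y (1 + b ln\<^sup>+(W/N)) \<le> M\<^bsup>-2/p\<^esup>\<close>, and the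
  change of argument adds at most \<open>y b ln\<^sup>+(P/W) = b m y ln\<^sup>+(1/y) \<le> b m / e\<close>.
\<close>

lemma replace_weight_in_log:
  fixes P W N M p b :: real and k :: nat
  assumes pos: "0 < P" "0 < W" "0 < N" "0 < M" "0 < p" "0 \<le> b" and k: "1 \<le> k"
    and le: "M * (1 + b * ln_plus (W / N)) powr (p / 2) \<le> (P / W) powr (1 / real k)"
  shows "((M powr (- 2 / p) + b * (real k * p / 2) / exp 1) powr (- p / 2)) ^ k * W \<le>
    P / (1 + b * ln_plus (P / N)) powr (real k * p / 2)"
proof -
  define m where "m = real k * p / 2"
  define y where "y = (W / P) powr (1 / m)"
  define D where "D = M powr (- 2 / p) + b * m / exp 1"
  define \<Lambda> where "\<Lambda> = 1 + b * ln_plus (W / N)"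
  define \<Lambda>' where "\<Lambda>' = 1 + b * ln_plus (P / N)"
  have m: "0 < m" using pos k by (simp add: m_def)
  have y: "0 < y" using pos by (simp add: y_def)
  have lp: "0 \<le> ln_plus z" for z by (simp add: ln_plus_def)
  have L: "1 \<le> \<Lambda>" "1 \<le> \<Lambda>'" using pos lp by (auto simp: \<Lambda>_def \<Lambda>'_def)
  have D: "0 < D" unfolding D_def using pos m by (intro add_pos_nonneg) auto
  have ym: "y powr m = W / P" using m pos by (simp add: y_def powr_powr)
  have "y * \<Lambda> \<le> M powr (- 2 / p)"
  proof -
    have "(M * \<Lambda> powr (p / 2)) powr (2 / p) \<le> ((P / W) powr (1 / real k)) powr (2 / p)"
      using le pos by (intro powr_mono2) (auto simp: \<Lambda>_def)
    moreover have "(M * \<Lambda> powr (p / 2)) powr (2 / p) = M powr (2 / p) * \<Lambda>"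
      using pos L by (simp add: powr_mult powr_powr)
    moreover have "((P / W) powr (1 / real k)) powr (2 / p) = 1 / y"
    proof -
      have "1 / m = 1 / real k * (2 / p)" by (simp add: m_def)
      then have "y = (W / P) powr (1 / real k * (2 / p))" by (simp only: y_def)
      then show ?thesis using pos by (simp only: powr_powr) (simp add: powr_divide)
    qed
    ultimately have "M powr (2 / p) * \<Lambda> \<le> 1 / y" by simp
    then have "y * \<Lambda> \<le> 1 / M powr (2 / p)" using y pos by (simp add: field_simps)
    then show ?thesis by (simp add: powr_minus_divide)
  qed
  moreover have "y * (b * ln_plus (P / W)) \<le> b * m / exp 1"
  proof -
    have "ln_plus (P / W) = m * ln_plus (1 / y)"
    proof -
      have "ln y = (ln W - ln P) / m" using pos m by (simp add: y_def ln_powr ln_div)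
      then have "ln (P / W) = m * ln (1 / y)" using pos y m by (simp add: ln_div)
      then show ?thesis using m by (simp add: ln_plus_def max_mult_distrib_left)
    qed
    then have "y * (b * ln_plus (P / W)) = b * m * (y * ln_plus (1 / y))" by simp
    also have "\<dots> \<le> b * m * (1 / exp 1)"
      using pos m y by (intro mult_left_mono mult_ln_plus_inverse_le) auto
    finally show ?thesis by simp
  qed
  moreover have "y * \<Lambda>' \<le> y * \<Lambda> + y * (b * ln_plus (P / W))"
  proof -
    have "ln_plus (P / N) \<le> ln_plus (W / N) + ln_plus (P / W)"
      using ln_plus_mult_le[of "W / N" "P / W"] pos by simp
    then have "b * ln_plus (P / N) \<le> b * (ln_plus (W / N) + ln_plus (P / W))"
      using pos by (intro mult_left_mono) auto
    then have "\<Lambda>' \<le> \<Lambda> + b * ln_plus (P / W)" by (simp add: \<Lambda>_def \<Lambda>'_def distrib_left)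
    then show ?thesis using y mult_left_mono[of \<Lambda>' "\<Lambda> + b * ln_plus (P / W)" y] by (simp add: distrib_left)
  qed
  ultimately have "y * \<Lambda>' \<le> D" by (simp add: D_def)
  then have "(y * \<Lambda>') powr m \<le> D powr m" using y L m by (intro powr_mono2) auto
  then have "W / P * \<Lambda>' powr m \<le> D powr m" by (simp add: powr_mult ym)
  then have "D powr (- m) * W \<le> P / \<Lambda>' powr m"
    using pos L D by (simp add: powr_minus field_simps)
  moreover have "(D powr (- p / 2)) ^ k = D powr (- m)"
    using D by (simp add: m_def powr_powr mult_ac flip: powr_realpow)
  ultimately show ?thesis by (simp add: D_def \<Lambda>'_def m_def)
qed

lemma cube_norm_powr:
  assumes "0 < p" "\<And>x. 0 \<le> g x"
  shows "cube_norm n p g powr r = cube_expectation n (\<lambda>x. g x powr p) powr (r / p)"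
  using assms by (simp add: cube_norm_def powr_powr)

section \<open>The main inequality\<close>

theorem theorem1p4:
  shows "(\<forall>n\<ge>1. \<forall>k\<le>n. \<forall>f :: (nat \<Rightarrow> real) \<Rightarrow> real. \<forall>p q :: real.
            (\<forall>x\<in>cube n. f x \<in> {-1..1}) \<longrightarrow> 1 \<le> q \<longrightarrow> q \<le> p \<longrightarrow> p \<le> 2 \<longrightarrow> q < 2 \<longrightarrow>
            cube_norm n p (grad_norm n k f) powr p /
              (1 + q / (2 * real k * (2 - q)) *
                 ln_plus (cube_norm n p (grad_norm n k f) powr p /
                          (cube_norm n q (grad_norm n k f))\<^sup>2)) powr (real k * p / 2)
            \<ge> C_const p q ^ k * high_weight n k f) \<and>
         (\<exists>c>0. \<forall>p q :: real. 1 \<le> q \<longrightarrow> q \<le> p \<longrightarrow> p \<le> 2 \<longrightarrow> q < 2 \<longrightarrow>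
            C_const p q \<ge> c * (2 - q))"
proof (intro conjI allI impI)
  fix n k :: nat and f :: "(nat \<Rightarrow> real) \<Rightarrow> real" and p q :: real
  assume "\<forall>x\<in>cube n. f x \<in> {-1..1}" and q: "1 \<le> q" "q \<le> p" "q < 2" and p2: "p \<le> 2"
  then have f: "\<And>x. x \<in> cube n \<Longrightarrow> f x \<in> {-1..1}" by blast
  have p: "1 \<le> p" "p \<le> 2" using q p2 by auto
  define W where "W = high_weight n k f"
  define P where "P = cube_expectation n (\<lambda>x. grad_norm n k f x powr p)"
  define N where "N = cube_expectation n (\<lambda>x. grad_norm n k f x powr q) powr (2 / q)"
  have P: "cube_norm n p (grad_norm n k f) powr p = P"
    using cube_norm_powr[of p "grad_norm n k f" n p] p
    by (simp add: P_def grad_norm_nonneg cube_expectation_nonneg)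
  have N: "(cube_norm n q (grad_norm n k f))\<^sup>2 = N"
    using cube_norm_powr[of q "grad_norm n k f" n 2] q
    by (simp add: N_def grad_norm_nonneg powr_numeral cube_norm_def)
  have Pnn: "0 \<le> P" unfolding P_def by (intro cube_expectation_nonneg) simp
  have Wnn: "0 \<le> W" by (simp add: W_def high_weight_def)
  have "C_const p q ^ k * W \<le> P / (1 + q / (2 * real k * (2 - q)) * ln_plus (P / N)) powr (real k * p / 2)"
  proof (cases "k = 0")
    case True
    have "{J. J \<subseteq> {1..n} \<and> card J = 0} = {{}}" by (auto simp: finite_subset)
    then have G: "grad_norm n k f x = \<bar>f x\<bar>" for x
      using True by (simp add: grad_norm_def derivs_empty)
    have "W = (\<Sum>S\<in>Pow {1..n}. fourier n f S * fourier n f S)"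
      using True by (simp add: W_def high_weight_fourier power2_eq_square Pow_def)
    also have "\<dots> = cube_expectation n (\<lambda>x. f x * f x)" by (rule parseval[symmetric])
    also have "\<dots> \<le> P" unfolding P_def G
    proof (rule cube_expectation_mono)
      fix x assume "x \<in> cube n"
      then have "\<bar>f x\<bar> \<le> 1" using f[of x] by (simp add: abs_le_iff)
      then have "\<bar>f x\<bar> powr 2 \<le> \<bar>f x\<bar> powr p" using p by (intro powr_mono') auto
      then show "f x * f x \<le> \<bar>f x\<bar> powr p" by (simp add: powr_numeral power2_eq_square)
    qed
    finally show ?thesis using True by simp
  next
    case False
    then have k: "1 \<le> k" by simp
    show ?thesis
    proof (cases "W = 0")
      case True
      then show ?thesis using Pnn by simp
    next
      case False
      then have W0: "0 < W" using Wnn by simp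
      have N0: "0 < N"
      proof (rule ccontr)
        assume "\<not> 0 < N"
        then have "cube_expectation n (\<lambda>x. grad_norm n k f x powr q) = 0" by (simp add: N_def)
        then have "\<forall>x\<in>cube n. grad_norm n k f x = 0" by (simp add: cube_expectation_eq_0_iff)
        then have "f \<in> grad_null n k"
          by (auto simp: grad_null_def grad_norm_def sum_nonneg_eq_0_iff)
        then show False using W0 by (simp add: grad_null_iff W_def high_weight_fourier)
      qed
      define b where "b = q / (2 * real k * (2 - q))"
      define \<Lambda> where "\<Lambda> = 1 + b * ln_plus (W / N)"
      have b: "0 \<le> b" using q by (simp add: b_def)
      have \<Lambda>: "1 \<le> \<Lambda>" using b by (simp add: \<Lambda>_def ln_plus_def)
      have main: "(1 - exp (- x)) ^ k * W \<le> P * (2 powr (p / 2) / p * (x / \<Lambda>) powr (p / 2)) ^ k"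
        if "0 < x" "x < 2" "x \<le> 2 * (2 - q) / q" for x
        unfolding W_def P_def \<Lambda>_def b_def
        by (rule high_weight_le[OF f k q(1,3) p that]) (use W0 N0 in \<open>auto simp: W_def N_def\<close>)
      have P0: "0 < P"
      proof -
        define x where "x = min 1 (2 * (2 - q) / q)"
        have x: "0 < x" "x < 2" "x \<le> 2 * (2 - q) / q" using q by (auto simp: x_def)
        then have "0 < (1 - exp (- x)) ^ k * W" using W0 by simp
        then have "P \<noteq> 0" using main[OF x] by auto
        then show ?thesis using Pnn by simp
      qed
      \<comment> \<open>\<open>main\<close>, solved for \<open>M_fun p x\<close>, bounds it by the same constant for all admissible \<open>x\<close>\<close>
      define z where "z = (P / W) powr (1 / real k)"
      have "(SUP x\<in>{0..}. M_fun p x) \<le> z / (p * 2 powr (- p / 2) * \<Lambda> powr (p / 2))"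
      proof (rule SUP_M_fun_le[OF p q])
        fix x assume x: "0 < x" "x < 2" "x \<le> 2 * (2 - q) / q"
        define y where "y = p * 2 powr (- p / 2) * \<Lambda> powr (p / 2) * M_fun p x"
        have c0: "0 < p * 2 powr (- p / 2) * \<Lambda> powr (p / 2)" using p \<Lambda> by simp
        have y0: "0 \<le> y" using p x by (simp add: y_def M_fun_def)
        have "y * (2 powr (p / 2) / p * (x / \<Lambda>) powr (p / 2)) = 1 - exp (- x)"
          using x p \<Lambda> by (simp add: y_def M_fun_def powr_divide powr_minus_divide)
        then have "(y * (2 powr (p / 2) / p * (x / \<Lambda>) powr (p / 2))) ^ k * W \<le>
            P * (2 powr (p / 2) / p * (x / \<Lambda>) powr (p / 2)) ^ k"
          using main[OF x] by simp
        then have "(y ^ k * W) * (2 powr (p / 2) / p * (x / \<Lambda>) powr (p / 2)) ^ k \<le>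
            P * (2 powr (p / 2) / p * (x / \<Lambda>) powr (p / 2)) ^ k"
          by (simp only: power_mult_distrib mult_ac)
        moreover have "0 < (2 powr (p / 2) / p * (x / \<Lambda>) powr (p / 2)) ^ k"
          using x p \<Lambda> by simp
        ultimately have "y ^ k * W \<le> P" by (simp only: mult_le_cancel_right_pos)
        then have "y ^ k \<le> P / W" using W0 by (simp add: field_simps)
        then have "(y ^ k) powr (1 / real k) \<le> z"
          unfolding z_def using y0 by (intro powr_mono2) auto
        then have "y \<le> z"
          using y0 k by (cases "y = 0") (auto simp: z_def powr_powr simp flip: powr_realpow)
        then show "M_fun p x \<le> z / (p * 2 powr (- p / 2) * \<Lambda> powr (p / 2))"
          using c0 by (simp add: y_def pos_le_divide_eq mult_ac)
      qed
      then have "M_const p * \<Lambda> powr (p / 2) \<le> z"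
        using p \<Lambda> by (simp add: M_const_def pos_le_divide_eq mult_ac)
      moreover have "0 < M_const p" using M_const_ge[OF p] by simp
      ultimately have "((M_const p powr (- 2 / p) + b * (real k * p / 2) / exp 1) powr (- p / 2)) ^ k * W \<le>
          P / (1 + b * ln_plus (P / N)) powr (real k * p / 2)"
        using P0 W0 N0 p b k by (intro replace_weight_in_log) (auto simp: z_def \<Lambda>_def)
      moreover have "b * (real k * p / 2) / exp 1 = p * q / (4 * exp 1 * (2 - q))"
        using k q by (simp add: b_def divide_simps)
      ultimately show ?thesis by (simp only: C_const_def b_def)
    qed
  qed
  then show "C_const p q ^ k * high_weight n k f \<le> cube_norm n p (grad_norm n k f) powr p /
      (1 + q / (2 * real k * (2 - q)) *
         ln_plus (cube_norm n p (grad_norm n k f) powr p /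
                  (cube_norm n q (grad_norm n k f))\<^sup>2)) powr (real k * p / 2)"
    unfolding P N W_def .
next
  show "\<exists>c>0. \<forall>p q :: real. 1 \<le> q \<longrightarrow> q \<le> p \<longrightarrow> p \<le> 2 \<longrightarrow> q < 2 \<longrightarrow> C_const p q \<ge> c * (2 - q)"
    by (rule exI[of _ "1 / 17"]) (use C_const_ge in auto)
qed

end
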